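(* Let $\ell\ge3$ and let $R=R(B_\ell,S_1,S_2)$ be a reduced extended affine root system of type $X=B_\ell$, nullity $\nu$ and twist number $t$. Then $R$ is a minimal extended affine root system if one of the following conditions holds: (a) $\mathrm{ind}(S_1)-t\le3$; (b) $t\le3$ and $\mathrm{ind}(S_1)\neq7$. In particular, if $t\le3$, then $R$ is minimal if and only if $\mathrm{ind}(S_1)\ne7$.
   Context: A semilattice in a finite-dimensional real vector space $U$ is a discrete spanning subset $S\subseteq U$ with $0\in S$ and $S=S\pm2S$; $\langle S\rangle$ is its $\mathbb Z$-span, and $S$ is a lattice if $S=\langle S\rangle$. If $\sigma_1,\dots,\sigma_n\in S$ form a $\mathbb Z$-basis of $\langle S\rangle$ (such elements exist), $\mathrm{supp}(S)=\{J\subseteq\{1,\dots,n\}:\sum_{r\in J}\sigma_r\in S\}$ and $\mathrm{ind}(S)=|\mathrm{supp}(S)|-1$ (equivalently, $\mathrm{ind}(S)+1$ is the number of cosets of $2\langle S\rangle$ contained in $S$). A reduced extended affine root system of type $B_\ell$ ($\ell\ge3$), nullity $\nu$ and twist number $t$ is described as follows: $\mathcal V=\dot{\mathcal V}\oplus\mathcal V^0$ is a real vector space with a positive semidefinite symmetric bilinear form with radical $\mathcal V^0=\mathcal V_1^0\oplus\mathcal V_2^0$, $\dim\mathcal V^0_1=t$, $\dim\mathcal V^0_2=\nu-t$; $\dot R=\{0\}\cup\dot R_{sh}\cup\dot R_{lg}$ is a finite root system of type $B_\ell$ spanning $\dot{\mathcal V}$ (short and long roots); $S_1$ is a semilattice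 in $\mathcal V_1^0$ and $S_2$ is a lattice in $\mathcal V_2^0$; with $S=S_1\oplus\langle S_2\rangle$, $R=R(B_\ell,S_1,S_2)=(S+S)\cup(\dot R_{sh}+S_1\oplus\langle S_2\rangle)\cup(\dot R_{lg}+2\langle S_1\rangle\oplus S_2)$. $R^\times=\{\alpha\in R:(\alpha,\alpha)\neq0\}$, $\alpha^\vee=2\alpha/(\alpha,\alpha)$. Let $\tilde{\mathcal V}=\mathcal V\oplus(\mathcal V^0)^*$ with the form extended by $(\dot\beta_1+\delta_1+\lambda_1,\dot\beta_2+\delta_2+\lambda_2)=(\dot\beta_1,\dot\beta_2)+\lambda_1(\delta_2)+\lambda_2(\delta_1)$ for $\dot\beta_i\in\dot{\mathcal V}$, $\delta_i\in\mathcal V^0$, $\lambda_i\in(\mathcal V^0)^*$. The Weyl group $\mathcal W$ is the subgroup of $GL(\tilde{\mathcal V})$ generated by $w_\alpha(u)=u-(u,\alpha^\vee)\alpha$, $\alpha\in R^\times$. $R$ is minimal if there is no $\alpha\in R^\times$ such that the reflections $w_\beta$, $\beta\in R^\times\setminus\mathcal W\alpha$, generate $\mathcal W$. *)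

theory Defs
  imports "HOL-Analysis.Analysis" "HOL-Algebra.Bij" "HOL-Algebra.Generated_Groups"
begin

global_interpretation int_module: module "\<lambda>(m::int) (x::'a::real_vector). of_int m *\<^sub>R x"
  defines zspan = int_module.span
    and zdependent = int_module.dependent
  by unfold_locales (simp_all add: scaleR_add_right scaleR_add_left)

text \<open>\<open>U\<close> is a subspace of the ambient Euclidean space. The Euclidean structure of the ambient
  type is only used for its topology, which is the canonical one of a finite-dimensional space.\<close>

definition semilattice_in :: "'v::euclidean_space set \<Rightarrow> 'v set \<Rightarrow> bool" where
  "semilattice_in U S \<longleftrightarrow>
     S \<subseteq> U \<and> span S = U \<and> discrete S \<and> 0 \<in> S \<and>
     S = {x + 2 *\<^sub>R y |x y. x \<in> S \<and> y \<in> S} \<union> {x - 2 *\<^sub>R y |x y. x \<in> S \<and> y \<in> S}"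

definition lattice_in :: "'v::euclidean_space set \<Rightarrow> 'v set \<Rightarrow> bool" where
  "lattice_in U S \<longleftrightarrow> semilattice_in U S \<and> S = zspan S"

definition zbasis_from :: "'v::euclidean_space set \<Rightarrow> nat \<Rightarrow> (nat \<Rightarrow> 'v) \<Rightarrow> bool" where
  "zbasis_from S n \<sigma> \<longleftrightarrow>
     \<sigma> ` {1..n} \<subseteq> S \<and> inj_on \<sigma> {1..n} \<and>
     \<not> zdependent (\<sigma> ` {1..n}) \<and> zspan (\<sigma> ` {1..n}) = zspan S"

definition supp :: "'v::euclidean_space set \<Rightarrow> nat \<Rightarrow> (nat \<Rightarrow> 'v) \<Rightarrow> nat set set" where
  "supp S n \<sigma> = {J. J \<subseteq> {1..n} \<and> (\<Sum>r\<in>J. \<sigma> r) \<in> S}"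

text \<open>The index does not depend on the basis chosen. Every semilattice \<open>S\<close> contains a basis
  of its integer span, so the choice below is proper, and \<open>0 \<in> S\<close> puts the empty set into the
  support, so the natural subtraction is never truncated.\<close>

definition ind :: "'v::euclidean_space set \<Rightarrow> nat" where
  "ind S = (let (n, \<sigma>) = (SOME (n, \<sigma>). zbasis_from S n \<sigma>) in card (supp S n \<sigma>) - 1)"

definition form_radical :: "('v \<Rightarrow> 'v \<Rightarrow> real) \<Rightarrow> 'v set" where
  "form_radical B = {x. \<forall>y. B x y = 0}"

text \<open>\<open>\<Phi>\<close> is a finite root system of type \<open>B\<^sub>l\<close> spanning \<open>W\<close>, with 0 counted as a root. As usual,
  \<open>\<epsilon>\<^sub>1, \<dots>, \<epsilon>\<^sub>l\<close> are orthogonal and of equal length; the normalisation \<open>c\<close> of the form is free.\<close>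

definition type_B :: "('v::real_vector \<Rightarrow> 'v \<Rightarrow> real) \<Rightarrow> nat \<Rightarrow> 'v set \<Rightarrow> 'v set \<Rightarrow> bool" where
  "type_B B l W \<Phi> \<longleftrightarrow>
     (\<exists>\<epsilon> c. c > 0 \<and>
        (\<forall>i\<in>{1..l}. \<forall>j\<in>{1..l}. B (\<epsilon> i) (\<epsilon> j) = (if i = j then c else 0)) \<and>
        span (\<epsilon> ` {1..l}) = W \<and>
        \<Phi> = {0} \<union> {s *\<^sub>R \<epsilon> i |s i. s \<in> {1, -1} \<and> i \<in> {1..l}}
              \<union> {s *\<^sub>R \<epsilon> i + s' *\<^sub>R \<epsilon> j |s s' i j.
                   s \<in> {1, -1} \<and> s' \<in> {1, -1} \<and> i \<in> {1..l} \<and> j \<in> {1..l} \<and> i \<noteq> j})"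

definition short_roots :: "('v::zero \<Rightarrow> 'v \<Rightarrow> real) \<Rightarrow> 'v set \<Rightarrow> 'v set" where
  "short_roots B \<Phi> = {\<alpha> \<in> \<Phi> - {0}. \<forall>\<beta>\<in>\<Phi> - {0}. B \<alpha> \<alpha> \<le> B \<beta> \<beta>}"

definition long_roots :: "('v::zero \<Rightarrow> 'v \<Rightarrow> real) \<Rightarrow> 'v set \<Rightarrow> 'v set" where
  "long_roots B \<Phi> = \<Phi> - {0} - short_roots B \<Phi>"

definition ears_B ::
  "('v::euclidean_space \<Rightarrow> 'v \<Rightarrow> real) \<Rightarrow> 'v set \<Rightarrow> 'v set \<Rightarrow> 'v set \<Rightarrow> 'v set" where
  "ears_B B \<Phi> S1 S2 =
     (let S = S1 + zspan S2 in
        (S + S) \<union> (short_roots B \<Phi> + S)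
          \<union> (long_roots B \<Phi> + ((\<lambda>x. 2 *\<^sub>R x) ` zspan S1 + S2)))"

definition nonisotropic :: "('v \<Rightarrow> 'v \<Rightarrow> real) \<Rightarrow> 'v set \<Rightarrow> 'v set" where
  "nonisotropic B R = {\<alpha> \<in> R. B \<alpha> \<alpha> \<noteq> 0}"

definition coroot :: "('v::real_vector \<Rightarrow> 'v \<Rightarrow> real) \<Rightarrow> 'v \<Rightarrow> 'v" where
  "coroot B \<alpha> = (2 / B \<alpha> \<alpha>) *\<^sub>R \<alpha>"

text \<open>Given a complement \<open>W\<close> of the radical \<open>V\<^sup>0\<close> in the space \<open>V\<close> (the whole type), the dual of
  \<open>V\<^sup>0\<close> is represented by the linear functionals on \<open>V\<close> vanishing on \<open>W\<close>, that is, by extending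
  functionals on \<open>V\<^sup>0\<close> by zero. So \<open>hyp_space W\<close> is the direct sum of \<open>V\<close> and the dual of \<open>V\<^sup>0\<close>.
  For \<open>v = \<beta> + \<delta>\<close> with \<open>\<beta> \<in> W\<close>, \<open>\<delta> \<in> V\<^sup>0\<close>, and \<open>\<lambda>\<close> in this dual, \<open>\<lambda> v = \<lambda> \<delta>\<close>; and
  \<open>B v\<^sub>1 v\<^sub>2 = B \<beta>\<^sub>1 \<beta>\<^sub>2\<close>. Hence no projections occur in \<open>hyp_form\<close>.\<close>

definition hyp_space :: "'v::euclidean_space set \<Rightarrow> ('v \<times> ('v \<Rightarrow>\<^sub>L real)) set" where
  "hyp_space W = {(v, f). \<forall>x\<in>W. blinfun_apply f x = 0}"

definition hyp_form ::
  "('v::euclidean_space \<Rightarrow> 'v \<Rightarrow> real) \<Rightarrow>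
     'v \<times> ('v \<Rightarrow>\<^sub>L real) \<Rightarrow> 'v \<times> ('v \<Rightarrow>\<^sub>L real) \<Rightarrow> real" where
  "hyp_form B p q =
     B (fst p) (fst q) + blinfun_apply (snd p) (fst q) + blinfun_apply (snd q) (fst p)"

definition GL :: "'a::real_vector set \<Rightarrow> ('a \<Rightarrow> 'a) monoid" where
  "GL X = BijGroup X \<lparr>carrier :=
     {f \<in> Bij X. (\<forall>x\<in>X. \<forall>y\<in>X. f (x + y) = f x + f y) \<and>
                 (\<forall>a. \<forall>x\<in>X. f (a *\<^sub>R x) = a *\<^sub>R f x)}\<rparr>"

definition reflection ::
  "('v::euclidean_space \<Rightarrow> 'v \<Rightarrow> real) \<Rightarrow> 'v set \<Rightarrow> 'v \<Rightarrow>
     'v \<times> ('v \<Rightarrow>\<^sub>L real) \<Rightarrow> 'v \<times> ('v \<Rightarrow>\<^sub>L real)" where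
  "reflection B W \<alpha> =
     (\<lambda>u\<in>hyp_space W. u - hyp_form B u (coroot B \<alpha>, 0) *\<^sub>R (\<alpha>, 0))"

definition weyl_group ::
  "('v::euclidean_space \<Rightarrow> 'v \<Rightarrow> real) \<Rightarrow> 'v set \<Rightarrow> 'v set \<Rightarrow>
     ('v \<times> ('v \<Rightarrow>\<^sub>L real) \<Rightarrow> 'v \<times> ('v \<Rightarrow>\<^sub>L real)) set" where
  "weyl_group B W R = generate (GL (hyp_space W)) (reflection B W ` nonisotropic B R)"

definition weyl_orbit ::
  "('v::euclidean_space \<Rightarrow> 'v \<Rightarrow> real) \<Rightarrow> 'v set \<Rightarrow> 'v set \<Rightarrow> 'v \<Rightarrow> 'v set" where
  "weyl_orbit B W R \<alpha> = {\<beta>. \<exists>w\<in>weyl_group B W R. w (\<alpha>, 0) = (\<beta>, 0)}"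

definition minimal_ears ::
  "('v::euclidean_space \<Rightarrow> 'v \<Rightarrow> real) \<Rightarrow> 'v set \<Rightarrow> 'v set \<Rightarrow> bool" where
  "minimal_ears B W R \<longleftrightarrow>
     \<not> (\<exists>\<alpha>\<in>nonisotropic B R.
          generate (GL (hyp_space W))
            (reflection B W ` (nonisotropic B R - weyl_orbit B W R \<alpha>)) = weyl_group B W R)"

end

theory Submission
  imports Defs
begin

text \<open>
  Let \<open>\<Lambda>\<close> be the integer span of \<open>S1\<close>, with a basis \<open>\<sigma> 1, \<dots>, \<sigma> n\<close> taken from \<open>S1\<close>; then \<open>n = t\<close>.
  Up to the shift by \<open>2\<Lambda>\<close> and \<open>S2\<close>, a short root \<open>\<plusminus>\<epsilon> i + \<delta>\<close> only remembers the set of those \<open>r\<close> for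
  which the coordinate of \<open>\<delta>\<close> at \<open>\<sigma> r\<close> is odd. This set is its parity class. It is a point of the
  support of \<open>S1\<close>, a subset of the cube over the field with two elements. The parity classes
  are exactly the orbits of short roots, and all long roots form one further orbit.

  The long orbit is never redundant, because reflections in short roots only change signs of
  the \<open>\<epsilon> i\<close>. Modulo the normal subgroup generated by the long reflections, the Weyl group is an
  elementary abelian 2-group, generated by one involution for each point \<open>p\<close> of the support. This
  involution behaves like the evaluation at \<open>p\<close> of all polynomials of degree at most 2. The
  monomial \<open>x\<^sub>r x\<^sub>s\<close> is visible in the action on the functional dual to \<open>\<sigma> r\<close>, whose image has a
  coordinate at \<open>\<sigma> s\<close> that, after halving, counts modulo 2 the short reflections with \<open>r\<close> and \<open>s\<close>
  in their parity class. The constant polynomial is visible in the parity of the number of sign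
  changes (\<open>tracks\<close> and \<open>reflection_group_tracks\<close>). So if the orbit of \<open>\<alpha>\<close> can be
  omitted, then some nonempty set \<open>P\<close> of points of the support is annihilated by all polynomials of
  degree at most 2 (\<open>redundant_orbit_imp_dependency\<close>); in coding theory, the indicator of \<open>P\<close> is a
  nonzero word of the Reed-Muller code of order \<open>n - 3\<close>.

  Such a \<open>P\<close> has at least four members with two or more elements
  (\<open>dependency_few_large_members\<close>). The support always contains the empty set and the \<open>n\<close>
  singletons, so the index is then at least \<open>n + 4\<close>; this is condition (a). For \<open>n \<le> 3\<close>, the set \<open>P\<close> must be the whole cube of
  dimension 3 (\<open>dependency_three_variables\<close>), and the index is 7; this is condition (b).

  Conversely, if the support is the whole cube of dimension 3, one of the eight
  reflections in \<open>\<beta> + \<sigma>\<^sub>J\<close>, where \<open>\<sigma>\<^sub>J\<close> is the sum of the \<open>\<sigma> r\<close> with \<open>r \<in> J\<close>, is an explicit product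
  of the other seven (\<open>eight_reflections\<close>). The reason is that a product of four reflections whose
  shifts form a parallelogram is a central transvection that depends only on the two sides of the
  parallelogram, and so it is the same for two opposite faces of the cube.

  The remaining input is the structure of semilattices: \<open>S1\<close> contains a basis of \<open>\<Lambda>\<close>
  (\<open>semilattice_contains_basis\<close>), and every such basis is linearly independent over the reals
  (\<open>zbasis_from_independent\<close>).
\<close>

section \<open>Dual functionals and integer spans\<close>

text \<open>The functional is the inner product with the component of \<open>x\<close> orthogonal to \<open>U\<close>, rescaled.\<close>

lemma separating_functional:
  fixes U :: "'v::euclidean_space set"
  assumes "x \<notin> span U"
  obtains f :: "'v \<Rightarrow>\<^sub>L real" where "\<And>u. u \<in> span U \<Longrightarrow> f u = 0" "f x = 1"
proof -
  obtain y z where y: "y \<in> span U" and z: "\<And>w. w \<in> span U \<Longrightarrow> orthogonal z w" and x: "x = y + z"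
    using orthogonal_subspace_decomp_exists[of U x] by metis
  have "z \<noteq> 0" using assms y x by auto
  then have zz: "z \<bullet> z \<noteq> 0" by simp
  have lin: "bounded_linear (\<lambda>w. (z \<bullet> w) / (z \<bullet> z))"
    by (rule bounded_linear_compose[OF bounded_linear_divide bounded_linear_inner_right])
  show thesis
  proof (rule that[of "Blinfun (\<lambda>w. (z \<bullet> w) / (z \<bullet> z))"])
    show "Blinfun (\<lambda>w. (z \<bullet> w) / (z \<bullet> z)) u = 0" if "u \<in> span U" for u
      using z[OF that] by (simp add: bounded_linear_Blinfun_apply[OF lin] orthogonal_def)
    have "z \<bullet> y = 0" using z[OF y] by (simp add: orthogonal_def)
    then show "Blinfun (\<lambda>w. (z \<bullet> w) / (z \<bullet> z)) x = 1"
      using zz by (simp add: bounded_linear_Blinfun_apply[OF lin] x inner_add_right)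
  qed
qed

text \<open>Coordinates with respect to \<open>T\<close> that ignore \<open>U\<close>. For \<open>U\<close> empty they are coordinates in the span
  of \<open>T\<close>; for roots, \<open>U\<close> consists of the part of the space whose coordinates are irrelevant.\<close>

lemma dual_basis_modulo:
  fixes T U :: "'v::euclidean_space set"
  assumes "\<And>b. b \<in> T \<Longrightarrow> b \<notin> span (U \<union> (T - {b}))"
  obtains e :: "'v \<Rightarrow> 'v \<Rightarrow>\<^sub>L real"
  where "\<And>b x. b \<in> T \<Longrightarrow> x \<in> span U \<Longrightarrow> e b x = 0"
    and "\<And>b b'. b \<in> T \<Longrightarrow> b' \<in> T \<Longrightarrow> e b b' = (if b = b' then 1 else 0)"
proof -
  have "\<exists>f :: 'v \<Rightarrow>\<^sub>L real. (\<forall>u \<in> span (U \<union> (T - {b})). f u = 0) \<and> f b = 1" if "b \<in> T" for b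
    using separating_functional[OF assms[OF that]] by metis
  then obtain e :: "'v \<Rightarrow> 'v \<Rightarrow>\<^sub>L real"
    where e: "\<And>b u. b \<in> T \<Longrightarrow> u \<in> span (U \<union> (T - {b})) \<Longrightarrow> e b u = 0"
      "\<And>b. b \<in> T \<Longrightarrow> e b b = 1"
    by metis
  show thesis
  proof (rule that[of e])
    fix b x assume b: "b \<in> T" and "x \<in> span U"
    then have "x \<in> span (U \<union> (T - {b}))" by (meson in_mono span_mono sup_ge1)
    with e(1) b show "e b x = 0" by blast
  next
    fix b b' assume b: "b \<in> T" "b' \<in> T"
    show "e b b' = (if b = b' then 1 else 0)"
      using e(1)[OF b(1), of b'] e(2)[OF b(1)] b by (auto intro: span_base)
  qed
qed

lemma independent_dual_basis:
  fixes T :: "'v::euclidean_space set"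
  assumes "independent T"
  obtains e :: "'v \<Rightarrow> 'v \<Rightarrow>\<^sub>L real"
  where "\<And>b b'. b \<in> T \<Longrightarrow> b' \<in> T \<Longrightarrow> e b b' = (if b = b' then 1 else 0)"
proof (rule dual_basis_modulo[of T "{}"])
  show "b \<notin> span ({} \<union> (T - {b}))" if "b \<in> T" for b
    using assms that by (simp add: dependent_def)
qed (rule that)

lemma blinfun_sum_scaleR:
  fixes f :: "'v::real_normed_vector \<Rightarrow>\<^sub>L real"
  shows "f (\<Sum>b\<in>T. u b *\<^sub>R g b) = (\<Sum>b\<in>T. u b * f (g b))"
  by (simp add: blinfun.sum_right blinfun.scaleR_right)

lemma blinfun_span_zero:
  fixes f :: "'v::real_normed_vector \<Rightarrow>\<^sub>L real"
  assumes "x \<in> span T" "\<And>b. b \<in> T \<Longrightarrow> f b = 0"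
  shows "f x = 0"
  using assms(1)
  by (induction rule: span_induct_alt)
    (auto simp: blinfun.add_right blinfun.scaleR_right blinfun.zero_right assms(2))

lemma zspan_subset_span: "zspan T \<subseteq> span T"
proof
  fix x assume "x \<in> zspan T"
  then show "x \<in> span T"
    by (induction rule: int_module.span_induct_alt) (auto intro: span_add span_scale span_base span_zero)
qed

lemma blinfun_zspan_Ints:
  fixes f :: "'v::real_normed_vector \<Rightarrow>\<^sub>L real"
  assumes "x \<in> zspan T" "\<And>b. b \<in> T \<Longrightarrow> f b \<in> \<int>"
  shows "f x \<in> \<int>"
  using assms(1)
  by (induction rule: int_module.span_induct_alt)
    (auto simp: blinfun.add_right blinfun.scaleR_right blinfun.zero_right assms(2))

lemma zspan_sum_Ints:
  assumes "\<And>b. b \<in> T \<Longrightarrow> u b \<in> \<int>" and "\<And>b. b \<in> T \<Longrightarrow> g b \<in> zspan A"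
  shows "(\<Sum>b\<in>T. u b *\<^sub>R g b) \<in> zspan A"
proof (rule int_module.span_sum)
  fix b assume "b \<in> T"
  then show "u b *\<^sub>R g b \<in> zspan A"
    using assms by (metis Ints_cases int_module.span_scale)
qed

lemma dual_basis_expansion:
  fixes e :: "'v::euclidean_space \<Rightarrow> 'v \<Rightarrow>\<^sub>L real"
  assumes "finite T" and e: "\<And>b b'. b \<in> T \<Longrightarrow> b' \<in> T \<Longrightarrow> e b b' = (if b = b' then 1 else 0)"
    and "x \<in> span T"
  shows "x = (\<Sum>b\<in>T. e b x *\<^sub>R b)"
proof -
  obtain u where x: "x = (\<Sum>b\<in>T. u b *\<^sub>R b)"
    using assms(3) span_finite[OF assms(1)] by auto
  have "e b x = u b" if "b \<in> T" for b
  proof -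
    have "e b x = (\<Sum>b'\<in>T. u b' * e b b')" unfolding x by (rule blinfun_sum_scaleR)
    also have "\<dots> = (\<Sum>b'\<in>T. if b = b' then u b' else 0)"
      using e that by (intro sum.cong) auto
    finally show ?thesis using that assms(1) by simp
  qed
  then show ?thesis by (subst x) (auto intro: sum.cong)
qed

section \<open>Bases of discrete subgroups\<close>

text \<open>Among the lattice points of \<open>span (insert v T)\<close> in a ball around a fundamental box, one with the
  smallest positive coordinate at \<open>v\<close> extends the basis: for any other lattice point \<open>y\<close>, subtracting a multiple
  of \<open>z\<close> makes the coordinate at \<open>v\<close> nonnegative and smaller than that of \<open>z\<close>, and subtracting integer
  parts at \<open>T\<close> moves the point into the box, so minimality makes this coordinate vanish.\<close>

lemma lattice_basis_step:
  fixes \<Lambda> T :: "'v::euclidean_space set"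
  assumes grp: "zspan \<Lambda> = \<Lambda>" and fin: "\<And>r. finite (\<Lambda> \<inter> cball 0 r)"
    and T: "independent T" "T \<subseteq> \<Lambda>" "\<Lambda> \<inter> span T \<subseteq> zspan T"
    and v: "v \<in> \<Lambda>" "v \<notin> span T"
  obtains z where "z \<in> \<Lambda>" "z \<notin> span T" "\<Lambda> \<inter> span (insert z T) \<subseteq> zspan (insert z T)"
proof -
  have finT: "finite T" using T(1) by (rule independent_imp_finite)
  have vT: "v \<notin> T" using v(2) span_base by blast
  have ind: "independent (insert v T)" using T(1) v(2) by (simp add: independent_insert)
  obtain e :: "'v \<Rightarrow> 'v \<Rightarrow>\<^sub>L real"
    where e: "\<And>b b'. b \<in> insert v T \<Longrightarrow> b' \<in> insert v T \<Longrightarrow> e b b' = (if b = b' then 1 else 0)"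
    by (rule independent_dual_basis[OF ind]) (rule that)
  note expand = dual_basis_expansion[of "insert v T" e, OF _ e]
  have ev_T: "e v x = 0" if "x \<in> span T" for x
    using that
  proof (rule blinfun_span_zero)
    show "e v b = 0" if "b \<in> T" for b
      using e[of v b] that vT by auto
  qed
  \<comment> \<open>The box of all combinations of \<open>insert v T\<close> with coefficients in \<open>[0, 1]\<close> lies in the ball of radius \<open>r\<close>.\<close>
  define r where "r = (\<Sum>b\<in>T. norm b) + norm v"
  define F where "F = {y \<in> \<Lambda> \<inter> cball 0 r. y \<in> span (insert v T) \<and> e v y > 0}"
  have "finite F" unfolding F_def by (rule finite_subset[OF _ fin[of r]]) auto
  moreover have "v \<in> F"
    using v(1) e by (auto simp: F_def r_def span_base sum_nonneg)
  ultimately have "Min (e v ` F) \<in> e v ` F" by (intro Min_in) auto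
  then obtain z where z: "z \<in> F" "e v z = Min (e v ` F)" by auto
  have zmin: "e v z \<le> e v y" if "y \<in> F" for y
    using that z(2) \<open>finite F\<close> by simp
  have zpos: "e v z > 0" and z\<Lambda>: "z \<in> \<Lambda>" and zspan: "z \<in> span (insert v T)"
    using z(1) by (auto simp: F_def)
  have zle1: "e v z \<le> 1" using zmin[OF \<open>v \<in> F\<close>] e by simp
  have mem_diff: "x - y \<in> \<Lambda>" if "x \<in> \<Lambda>" "y \<in> \<Lambda>" for x y
    using that int_module.span_diff[of x \<Lambda> y] unfolding grp by blast
  have mem_scale: "of_int m *\<^sub>R x \<in> \<Lambda>" if "x \<in> \<Lambda>" for x m
    using that int_module.span_scale[of x \<Lambda> m] unfolding grp by blast
  have "z \<notin> span T" using ev_T[of z] zpos by auto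
  moreover have "\<Lambda> \<inter> span (insert z T) \<subseteq> zspan (insert z T)"
  proof
    fix y assume y: "y \<in> \<Lambda> \<inter> span (insert z T)"
    have "span (insert z T) \<subseteq> span (insert v T)"
      by (intro span_minimal) (auto simp: zspan intro: span_base)
    with y have yv: "y \<in> span (insert v T)" by auto
    define m where "m = \<lfloor>e v y / e v z\<rfloor>"
    \<comment> \<open>\<open>y1\<close> has a smaller coordinate at \<open>v\<close> than \<open>z\<close>, and \<open>y2\<close> is its representative in the box.\<close>
    define y1 where "y1 = y - of_int m *\<^sub>R z"
    have y1\<Lambda>: "y1 \<in> \<Lambda>"
      unfolding y1_def using y z\<Lambda> by (intro mem_diff mem_scale) auto
    have y1v: "y1 \<in> span (insert v T)"
      unfolding y1_def using yv zspan by (intro span_diff span_scale)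
    have ev1: "e v y1 = e v y - of_int m * e v z"
      by (simp add: y1_def blinfun.diff_right blinfun.scaleR_right)
    have "of_int m \<le> e v y / e v z" "e v y / e v z < of_int m + 1"
      unfolding m_def by linarith+
    then have ev1_0: "0 \<le> e v y1" and ev1_z: "e v y1 < e v z"
      unfolding ev1 using zpos by (simp_all add: field_simps)
    have "y1 = (\<Sum>b\<in>insert v T. e b y1 *\<^sub>R b)"
      by (rule expand) (use finT y1v in auto)
    also have "\<dots> = e v y1 *\<^sub>R v + (\<Sum>b\<in>T. e b y1 *\<^sub>R b)"
      using finT vT by simp
    finally have y1_eq: "(\<Sum>b\<in>T. e b y1 *\<^sub>R b) = y1 - e v y1 *\<^sub>R v"
      by (metis add_diff_cancel_left')
    define y2 where "y2 = y1 - (\<Sum>b\<in>T. of_int \<lfloor>e b y1\<rfloor> *\<^sub>R b)"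
    have sumT: "(\<Sum>b\<in>T. of_int \<lfloor>e b y1\<rfloor> *\<^sub>R b) \<in> zspan T"
      by (intro zspan_sum_Ints) (auto intro: int_module.span_base)
    have "zspan T \<subseteq> \<Lambda>" using T(2) grp int_module.span_mono by blast
    with sumT y1\<Lambda> have y2\<Lambda>: "y2 \<in> \<Lambda>"
      unfolding y2_def by (intro mem_diff) auto
    have "zspan T \<subseteq> span (insert v T)"
      using zspan_subset_span span_mono[of T "insert v T"] by blast
    with sumT y1v have y2v: "y2 \<in> span (insert v T)"
      unfolding y2_def by (intro span_diff) auto
    have ev2: "e v y2 = e v y1"
      using ev_T[OF subsetD[OF zspan_subset_span sumT]] by (simp add: y2_def blinfun.diff_right)
    have y2_eq: "y2 = e v y1 *\<^sub>R v + (\<Sum>b\<in>T. frac (e b y1) *\<^sub>R b)"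
      unfolding y2_def frac_def scaleR_diff_left sum_subtractf y1_eq by simp
    have "norm y2 \<le> norm (e v y1 *\<^sub>R v) + (\<Sum>b\<in>T. norm (frac (e b y1) *\<^sub>R b))"
      unfolding y2_eq by (rule order_trans[OF norm_triangle_ineq add_left_mono[OF norm_sum]])
    also have "\<dots> \<le> norm v + (\<Sum>b\<in>T. norm b)"
    proof (rule add_mono)
      show "norm (e v y1 *\<^sub>R v) \<le> norm v"
        using ev1_0 ev1_z zle1 by (simp add: mult_left_le_one_le)
      show "(\<Sum>b\<in>T. norm (frac (e b y1) *\<^sub>R b)) \<le> (\<Sum>b\<in>T. norm b)"
        by (intro sum_mono) (simp add: mult_left_le_one_le less_imp_le[OF frac_lt_1])
    qed
    finally have "y2 \<in> cball 0 r" by (simp add: r_def)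
    then have "y2 \<in> F" if "e v y1 > 0"
      using that y2\<Lambda> y2v ev2 unfolding F_def by simp
    then have ev1_eq0: "e v y1 = 0"
      using zmin[of y2] ev2 ev1_0 ev1_z by linarith
    have "(\<Sum>b\<in>T. e b y1 *\<^sub>R b) \<in> span T"
      by (intro span_sum span_scale span_base)
    then have "y1 \<in> span T"
      unfolding y1_eq ev1_eq0 by simp
    then have "y1 \<in> zspan T" using T(3) y1\<Lambda> by blast
    then have "y1 \<in> zspan (insert z T)" using int_module.span_mono by blast
    moreover have "of_int m *\<^sub>R z \<in> zspan (insert z T)"
      by (intro int_module.span_scale int_module.span_base) simp
    ultimately have "y1 + of_int m *\<^sub>R z \<in> zspan (insert z T)"
      by (rule int_module.span_add)
    then show "y \<in> zspan (insert z T)" by (simp add: y1_def)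
  qed
  ultimately show thesis using that z\<Lambda> by blast
qed

text \<open>A largest independent subset \<open>T\<close> that generates all lattice points in its real span is a basis,
  since it could be extended otherwise.\<close>

lemma discrete_subgroup_has_basis:
  fixes \<Lambda> :: "'v::euclidean_space set"
  assumes grp: "zspan \<Lambda> = \<Lambda>" and fin: "\<And>r. finite (\<Lambda> \<inter> cball 0 r)"
  obtains T where "independent T" "zspan T = \<Lambda>"
proof -
  define P where "P T \<longleftrightarrow> independent T \<and> T \<subseteq> \<Lambda> \<and> \<Lambda> \<inter> span T \<subseteq> zspan T" for T
  have "P {}" by (auto simp: P_def int_module.span_zero independent_empty)
  moreover have "card T < Suc DIM('v)" if "P T" for T
    using that independent_bound[of T] unfolding P_def by auto
  ultimately obtain T where T: "P T" and max: "\<And>T'. P T' \<Longrightarrow> card T' \<le> card T"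
    using ex_has_greatest_nat[of P "{}" card "Suc DIM('v)"] by (metis less_le)
  then have T': "independent T" "T \<subseteq> \<Lambda>" "\<Lambda> \<inter> span T \<subseteq> zspan T" by (auto simp: P_def)
  have "\<Lambda> \<subseteq> span T"
  proof
    fix v assume v: "v \<in> \<Lambda>"
    show "v \<in> span T"
    proof (rule ccontr)
      assume "v \<notin> span T"
      then obtain z where z: "z \<in> \<Lambda>" "z \<notin> span T" "\<Lambda> \<inter> span (insert z T) \<subseteq> zspan (insert z T)"
        using lattice_basis_step[OF grp fin T' v] by blast
      then have "P (insert z T)" using T' by (auto simp: P_def independent_insert)
      from max[OF this] z(2) T'(1) independent_imp_finite[OF T'(1)] show False
        by (metis card_insert_disjoint not_less_eq_eq order_refl span_base)
    qed
  qed
  with T' have "\<Lambda> \<subseteq> zspan T" by blast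
  moreover have "zspan T \<subseteq> \<Lambda>" using T'(2) grp int_module.span_mono by blast
  ultimately show thesis using that T'(1) by blast
qed

section \<open>Bases contained in semilattices\<close>

text \<open>The defining condition gives closure under \<open>x \<mapsto> x \<plusminus> 2y\<close> for \<open>y\<close> in \<open>S\<close>, and the set of all \<open>y\<close> with
  this closure property is a subgroup. So a semilattice is a union of cosets of twice its span.\<close>

lemma semilattice_add_double:
  assumes S: "semilattice_in U S" and x: "x \<in> S" and y: "y \<in> zspan S"
  shows "x + 2 *\<^sub>R y \<in> S"
proof -
  have base: "x + 2 *\<^sub>R y \<in> S" "x - 2 *\<^sub>R y \<in> S" if "x \<in> S" "y \<in> S" for x y
    using S that unfolding semilattice_in_def by blast+
  define H where "H = {y. \<forall>x\<in>S. x + 2 *\<^sub>R y \<in> S \<and> x - 2 *\<^sub>R y \<in> S}"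
  have H0: "0 \<in> H" by (simp add: H_def)
  have Hadd: "a + b \<in> H" if ab: "a \<in> H" "b \<in> H" for a b
    unfolding H_def
  proof (intro CollectI ballI conjI)
    fix x assume x: "x \<in> S"
    have "(x + 2 *\<^sub>R a) + 2 *\<^sub>R b \<in> S" using ab x unfolding H_def by blast
    then show "x + 2 *\<^sub>R (a + b) \<in> S" by (simp add: scaleR_add_right add.assoc)
    have "(x - 2 *\<^sub>R a) - 2 *\<^sub>R b \<in> S" using ab x unfolding H_def by blast
    then show "x - 2 *\<^sub>R (a + b) \<in> S" by (simp add: scaleR_add_right diff_diff_eq)
  qed
  have Hneg: "- a \<in> H" if "a \<in> H" for a using that by (simp add: H_def)
  have Hnat: "real k *\<^sub>R a \<in> H" if "a \<in> H" for a k
    by (induction k) (use H0 Hadd that in \<open>auto simp: scaleR_add_left add.commute\<close>)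
  have Hint: "of_int m *\<^sub>R a \<in> H" if "a \<in> H" for a m
  proof (cases m rule: int_cases2)
    case (nonpos k)
    then show ?thesis using Hneg[OF Hnat[OF that, of k]] by simp
  qed (use Hnat[OF that] in simp)
  have "S \<subseteq> H" using base by (auto simp: H_def)
  from y have "y \<in> H"
    by (induction rule: int_module.span_induct_alt) (use H0 Hadd Hint \<open>S \<subseteq> H\<close> in auto)
  with x show ?thesis by (auto simp: H_def)
qed

text \<open>Discreteness passes from \<open>S\<close> to its integer span because twice the span is contained in \<open>S\<close>.\<close>

lemma semilattice_zspan_locally_finite:
  fixes S :: "'v::euclidean_space set"
  assumes S: "semilattice_in U S"
  shows "finite (zspan S \<inter> cball 0 r)"
proof -
  have "0 \<in> S" "discrete S" using S by (auto simp: semilattice_in_def)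
  then have "0 isolated_in S" by (auto simp: discrete_def)
  then obtain \<epsilon> where eps: "\<epsilon> > 0" "\<And>y. y \<in> S \<Longrightarrow> dist 0 y < \<epsilon> \<Longrightarrow> y = 0"
    by (auto simp: isolated_in_dist_Ex_iff)
  \<comment> \<open>If \<open>x\<close> has small norm, then \<open>2x\<close> is a point of \<open>S\<close> close to \<open>0\<close>.\<close>
  have sep: "x = 0" if "x \<in> zspan S" "norm x < \<epsilon> / 2" for x
  proof -
    have "0 + 2 *\<^sub>R x \<in> S" using semilattice_add_double[OF S \<open>0 \<in> S\<close> that(1)] .
    with eps(2)[of "2 *\<^sub>R x"] that(2) show ?thesis by simp
  qed
  have "uniform_discrete (zspan S)"
    unfolding uniform_discrete_def
  proof (intro exI[of _ "\<epsilon> / 2"] conjI ballI impI)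
    fix x y assume "x \<in> zspan S" "y \<in> zspan S" "dist x y < \<epsilon> / 2"
    then show "x = y" using sep[of "x - y"] int_module.span_diff by (auto simp: dist_norm)
  qed (use eps in auto)
  then have "closed (zspan S)" "discrete (zspan S)"
    using uniform_discrete_imp_closed uniform_discrete_imp_discrete by blast+
  then have "\<not> z islimpt zspan S" for z
    by (meson closed_limpt discreteD isolated_in_islimpt_iff)
  then have "finite (cball 0 r \<inter> zspan S)"
    by (intro finite_not_islimpt_in_compact) auto
  then show ?thesis by (simp add: Int_commute)
qed

text \<open>Not all of \<open>S\<close> can have an even coordinate at \<open>b\<close>, as \<open>b\<close> is itself an integer combination of
  elements of \<open>S\<close>. Reducing the coordinates of an element with odd coordinate at \<open>b\<close> modulo 2 gives a sum
  of distinct basis vectors including \<open>b\<close>, which still belongs to \<open>S\<close> and can replace \<open>b\<close>.\<close>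

lemma lattice_basis_exchange:
  fixes T S :: "'v::euclidean_space set"
  assumes T: "independent T" "zspan T = zspan S" and b: "b \<in> T" "b \<notin> S"
    and S: "\<And>x y. x \<in> S \<Longrightarrow> y \<in> zspan S \<Longrightarrow> x + 2 *\<^sub>R y \<in> S"
  obtains T' where "independent T'" "zspan T' = zspan S" "card (T' \<inter> S) > card (T \<inter> S)"
proof -
  have finT: "finite T" using T(1) by (rule independent_imp_finite)
  obtain e :: "'v \<Rightarrow> 'v \<Rightarrow>\<^sub>L real"
    where e: "\<And>b b'. b \<in> T \<Longrightarrow> b' \<in> T \<Longrightarrow> e b b' = (if b = b' then 1 else 0)"
    by (rule independent_dual_basis[OF T(1)]) (rule that)
  note expand = dual_basis_expansion[OF finT e]
  have eInt: "e b x \<in> \<int>" if "x \<in> zspan T" "b \<in> T" for b x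
    using that(1) by (rule blinfun_zspan_Ints) (use e that in auto)
  have "\<exists>s\<in>S. odd \<lfloor>e b s\<rfloor>"
  proof (rule ccontr)
    assume no: "\<not> (\<exists>s\<in>S. odd \<lfloor>e b s\<rfloor>)"
    \<comment> \<open>If the coordinate at \<open>b\<close> were even on all of \<open>S\<close>, half of it would be integral at \<open>b\<close>, where it is \<open>1/2\<close>.\<close>
    have half: "((1/2) *\<^sub>R e b) s \<in> \<int>" if "s \<in> S" for s
    proof -
      have "e b s \<in> \<int>" using that T(2) by (intro eInt b) (auto intro: int_module.span_base)
      moreover have "even \<lfloor>e b s\<rfloor>" using no that by blast
      ultimately obtain k where "e b s = of_int (2 * k)"
        by (metis evenE floor_of_int Ints_cases)
      then show ?thesis by (simp add: scaleR_blinfun.rep_eq)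
    qed
    have "b \<in> zspan S" using b(1) T(2) int_module.span_base by blast
    then have "((1/2) *\<^sub>R e b) b \<in> \<int>" by (rule blinfun_zspan_Ints) (rule half)
    then have "(1/2::real) \<in> \<int>" using e b by (simp add: scaleR_blinfun.rep_eq)
    then obtain k::int where "1/2 = real_of_int k" by (auto elim: Ints_cases)
    then have "real_of_int (2 * k) = 1" by simp
    then have "2 * k = 1" by linarith
    then show False by presburger
  qed
  then obtain s where s: "s \<in> S" "odd \<lfloor>e b s\<rfloor>" by blast
  have sT: "s \<in> zspan T" using s(1) T(2) int_module.span_base by blast
  define J where "J = {x \<in> T. odd \<lfloor>e x s\<rfloor>}"
  define s' where "s' = \<Sum>J"
  have bJ: "b \<in> J" using b s by (simp add: J_def)
  have JT: "J \<subseteq> T" by (auto simp: J_def)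
  have "s = (\<Sum>x\<in>T. e x s *\<^sub>R x)" using sT zspan_subset_span by (intro expand) auto
  also have "\<dots> = (\<Sum>x\<in>T. of_bool (x \<in> J) *\<^sub>R x + (2 * of_int (\<lfloor>e x s\<rfloor> div 2)) *\<^sub>R x)"
  proof (rule sum.cong[OF refl])
    fix x assume x: "x \<in> T"
    have "e x s = of_int \<lfloor>e x s\<rfloor>" using eInt[OF sT x] by (auto elim: Ints_cases)
    also have "\<lfloor>e x s\<rfloor> = of_bool (x \<in> J) + 2 * (\<lfloor>e x s\<rfloor> div 2)"
      using x unfolding J_def by (cases "odd \<lfloor>e x s\<rfloor>") (auto elim!: oddE)
    finally have "e x s = of_bool (x \<in> J) + 2 * of_int (\<lfloor>e x s\<rfloor> div 2)"
      by (smt (verit) of_int_add of_int_mult of_int_numeral of_int_of_bool)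
    then show "e x s *\<^sub>R x = of_bool (x \<in> J) *\<^sub>R x + (2 * of_int (\<lfloor>e x s\<rfloor> div 2)) *\<^sub>R x"
      by (metis scaleR_add_left)
  qed
  also have "\<dots> = (\<Sum>x\<in>T. of_bool (x \<in> J) *\<^sub>R x) + 2 *\<^sub>R (\<Sum>x\<in>T. of_int (\<lfloor>e x s\<rfloor> div 2) *\<^sub>R x)"
    by (simp add: sum.distrib scaleR_sum_right)
  also have "(\<Sum>x\<in>T. of_bool (x \<in> J) *\<^sub>R x) = s'"
    using finT JT by (auto simp: s'_def of_bool_def if_distrib[of "\<lambda>a. a *\<^sub>R _"] sum.If_cases Int_absorb1 intro!: sum.cong cong: if_cong)
  finally have s'_eq: "s' = s + 2 *\<^sub>R (- (\<Sum>x\<in>T. of_int (\<lfloor>e x s\<rfloor> div 2) *\<^sub>R x))"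
    by (simp add: algebra_simps)
  have "- (\<Sum>x\<in>T. of_int (\<lfloor>e x s\<rfloor> div 2) *\<^sub>R x) \<in> zspan S"
    unfolding T(2)[symmetric] by (intro int_module.span_neg zspan_sum_Ints) (auto intro: int_module.span_base)
  then have s'S: "s' \<in> S" unfolding s'_eq using S s(1) by blast
  define T' where "T' = insert s' (T - {b})"
  have s'b: "s' = b + \<Sum>(J - {b})"
    unfolding s'_def using sum.remove[OF finite_subset[OF JT finT] bJ, of "\<lambda>x. x"] by simp
  have restz: "\<Sum>(J - {b}) \<in> zspan (T - {b})"
    using JT by (intro int_module.span_sum int_module.span_base) auto
  then have rest: "\<Sum>(J - {b}) \<in> span (T - {b})" using zspan_subset_span by blast
  have s'n: "s' \<notin> span (T - {b})"
  proof
    assume "s' \<in> span (T - {b})"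
    then have "s' - \<Sum>(J - {b}) \<in> span (T - {b})" using rest by (rule span_diff)
    then show False using T(1) b(1) unfolding s'b dependent_def by auto
  qed
  have indT': "independent T'"
    unfolding T'_def using s'n T(1) by (simp add: independent_insert independent_mono[of T])
  have "b = s' - \<Sum>(J - {b})" by (simp add: s'b)
  moreover have "s' \<in> zspan T'" "\<Sum>(J - {b}) \<in> zspan T'"
    using restz int_module.span_mono[of "T - {b}" T'] by (auto simp: T'_def intro: int_module.span_base)
  ultimately have "b \<in> zspan T'" by (metis int_module.span_diff)
  then have "T \<subseteq> zspan T'" by (auto simp: T'_def intro: int_module.span_base)
  moreover have "T' \<subseteq> zspan T"
    using s'S T(2) by (auto simp: T'_def intro: int_module.span_base)
  ultimately have "zspan T' = zspan S"
    unfolding T(2)[symmetric] by (meson int_module.span_minimal int_module.subspace_span subset_antisym)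
  moreover have "T' \<inter> S = insert s' (T \<inter> S)" using s'S b(2) by (auto simp: T'_def)
  moreover have "s' \<notin> T \<inter> S"
    using s'n b(2) s'S by (metis DiffI IntE empty_iff insert_iff span_base)
  ultimately show thesis
    using that[of T'] indT' finT by simp
qed

text \<open>A basis of the integer span with as many members in \<open>S\<close> as possible lies in \<open>S\<close>, because otherwise
  another member could be exchanged.\<close>

lemma semilattice_contains_basis:
  fixes S :: "'v::euclidean_space set"
  assumes S: "semilattice_in U S"
  obtains T where "independent T" "T \<subseteq> S" "zspan T = zspan S"
proof -
  define P where "P T \<longleftrightarrow> independent T \<and> zspan T = zspan S" for T
  have idem: "zspan (zspan S) = zspan S" by (rule int_module.span_span)
  obtain T0 where "independent T0" "zspan T0 = zspan S"
    using discrete_subgroup_has_basis[OF idem semilattice_zspan_locally_finite[OF S]] .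
  then have "P T0" by (simp add: P_def)
  moreover have "card (T \<inter> S) < Suc DIM('v)" if "P T" for T
  proof -
    have "finite T" "card T \<le> DIM('v)"
      using that independent_bound[of T] unfolding P_def by auto
    then show ?thesis using card_mono[of T "T \<inter> S"] by simp
  qed
  ultimately obtain T where T: "P T" and max: "\<And>T'. P T' \<Longrightarrow> card (T' \<inter> S) \<le> card (T \<inter> S)"
    using ex_has_greatest_nat[of P T0 "\<lambda>T. card (T \<inter> S)" "Suc DIM('v)"] by (metis less_le)
  have "T \<subseteq> S"
  proof
    fix b assume "b \<in> T"
    show "b \<in> S"
    proof (rule ccontr)
      assume "b \<notin> S"
      with T \<open>b \<in> T\<close> obtain T' where "P T'" "card (T' \<inter> S) > card (T \<inter> S)"
        using lattice_basis_exchange[of T S b] semilattice_add_double[OF S] unfolding P_def by metis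
      with max show False by (metis leD)
    qed
  qed
  with T that show thesis by (auto simp: P_def)
qed

lemma independent_imp_not_zdependent:
  assumes "independent T"
  shows "\<not> zdependent T"
proof
  assume "zdependent T"
  then obtain t u where t: "finite t" "t \<subseteq> T" "(\<Sum>v\<in>t. of_int (u v) *\<^sub>R v) = 0" "\<exists>v\<in>t. u v \<noteq> (0::int)"
    unfolding int_module.dependent_explicit by blast
  then show False
    using assms independent_explicit_module[of T] by (metis of_int_eq_0_iff)
qed

lemma zbasis_from_ind:
  fixes S :: "'v::euclidean_space set"
  assumes S: "semilattice_in U S"
  obtains n \<sigma> where "zbasis_from S n \<sigma>" "ind S = card (supp S n \<sigma>) - 1"
proof -
  obtain T where T: "independent T" "T \<subseteq> S" "zspan T = zspan S"
    using semilattice_contains_basis[OF S] .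
  obtain n where n: "n = card T" by blast
  obtain \<sigma> where sig: "bij_betw \<sigma> {1..n} T"
    using ex_bij_betw_nat_finite_1[OF independent_imp_finite[OF T(1)]] n by blast
  have "zbasis_from S n \<sigma>"
    using sig T independent_imp_not_zdependent[OF T(1)] by (auto simp: zbasis_from_def bij_betw_def)
  then have "case (SOME (n, \<sigma>). zbasis_from S n \<sigma>) of (n, \<sigma>) \<Rightarrow> zbasis_from S n \<sigma>"
    by (intro someI[of "\<lambda>(n, \<sigma>). zbasis_from S n \<sigma>" "(n, \<sigma>)"]) simp
  then show thesis using that unfolding ind_def by (auto split: prod.splits simp: Let_def)
qed

text \<open>If \<open>T\<close> is a basis of the integer span that is independent over the reals, then distinct
  subset sums of \<open>\<sigma>\<close> have distinct coordinates modulo 2 with respect to \<open>T\<close>. Hence \<open>2\<^sup>n\<close> is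
  at most \<open>2\<close> to the power \<open>card T\<close>, and a spanning set of at most \<open>dim U\<close> vectors is independent.\<close>

lemma zbasis_from_independent:
  fixes S :: "'v::euclidean_space set"
  assumes S: "semilattice_in U S" and \<sigma>: "zbasis_from S n \<sigma>"
  shows "n = dim U" "independent (\<sigma> ` {1..n})"
proof -
  obtain T where T: "independent T" "T \<subseteq> S" "zspan T = zspan S"
    using semilattice_contains_basis[OF S] .
  have finT: "finite T" using T(1) by (rule independent_imp_finite)
  have inj: "inj_on \<sigma> {1..n}" and sS: "\<sigma> ` {1..n} \<subseteq> S" and nd: "\<not> zdependent (\<sigma> ` {1..n})"
    and sz: "zspan (\<sigma> ` {1..n}) = zspan S"
    using \<sigma> by (auto simp: zbasis_from_def)
  have U: "span S = U" using S by (simp add: semilattice_in_def)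
  have "span S \<subseteq> span A" if "zspan A = zspan S" for A
    by (rule span_minimal) (use that zspan_subset_span[of A] in \<open>auto intro: int_module.span_base\<close>)
  then have span: "span T = U" "span (\<sigma> ` {1..n}) = U"
    using span_mono[OF T(2)] span_mono[OF sS] T(3) sz unfolding U by blast+
  have dimT: "dim U = card T"
    unfolding span(1)[symmetric] dim_span by (rule dim_eq_card_independent[OF T(1)])
  obtain e :: "'v \<Rightarrow> 'v \<Rightarrow>\<^sub>L real"
    where e: "\<And>b b'. b \<in> T \<Longrightarrow> b' \<in> T \<Longrightarrow> e b b' = (if b = b' then 1 else 0)"
    by (rule independent_dual_basis[OF T(1)]) (rule that)
  have eInt: "e b x \<in> \<int>" if "x \<in> zspan T" "b \<in> T" for b x
    using that(1) by (rule blinfun_zspan_Ints) (use e that in auto)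
  define g where "g J = {b \<in> T. odd \<lfloor>e b (sum \<sigma> J)\<rfloor>}" for J
  have sumz: "sum \<sigma> J \<in> zspan T" if "J \<subseteq> {1..n}" for J
    unfolding T(3) sz[symmetric] using that by (intro int_module.span_sum int_module.span_base) auto
  have "inj_on g (Pow {1..n})"
  proof (rule inj_onI)
    fix J K assume JK: "J \<in> Pow {1..n}" "K \<in> Pow {1..n}" and eq: "g J = g K"
    define d where "d = sum \<sigma> J - sum \<sigma> K"
    have dz: "d \<in> zspan T" unfolding d_def using JK sumz by (intro int_module.span_diff) auto
    have even: "e b ((1/2) *\<^sub>R d) \<in> \<int>" if b: "b \<in> T" for b
    proof -
      obtain j k where jk: "e b (sum \<sigma> J) = of_int j" "e b (sum \<sigma> K) = of_int k"
        using eInt[OF sumz[OF PowD[OF JK(1)]] b] eInt[OF sumz[OF PowD[OF JK(2)]] b]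
      by (auto elim!: Ints_cases)
      have "b \<in> g J \<longleftrightarrow> b \<in> g K" using eq by simp
      then have "odd j \<longleftrightarrow> odd k" using b jk by (simp add: g_def)
      then have "even (j - k)" by simp
      then obtain m where "j - k = 2 * m" by blast
      then have "e b ((1/2) *\<^sub>R d) = of_int m"
        using jk by (simp add: d_def blinfun.scaleR_right blinfun.diff_right flip: of_int_diff)
      then show ?thesis by simp
    qed
    have "(1/2) *\<^sub>R d = (\<Sum>b\<in>T. e b ((1/2) *\<^sub>R d) *\<^sub>R b)"
      by (rule dual_basis_expansion[OF finT e]) (use dz zspan_subset_span in \<open>auto intro: span_scale\<close>)
    also have "\<dots> \<in> zspan T" using even by (intro zspan_sum_Ints) (auto intro: int_module.span_base)
    finally have "(1/2) *\<^sub>R d \<in> zspan (\<sigma> ` {1..n})" using T(3) sz by simp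
    then obtain u where "(1/2) *\<^sub>R d = (\<Sum>x\<in>\<sigma> ` {1..n}. of_int (u x) *\<^sub>R x)"
      using int_module.span_finite[of "\<sigma> ` {1..n}"] by auto
    then have half: "(1/2) *\<^sub>R d = (\<Sum>r\<in>{1..n}. of_int (u (\<sigma> r)) *\<^sub>R \<sigma> r)"
      using inj by (simp add: sum.reindex)
    have ind_sum: "sum \<sigma> A = (\<Sum>r\<in>{1..n}. of_int (of_bool (r \<in> A)) *\<^sub>R \<sigma> r)" if "A \<subseteq> {1..n}" for A
      using that by (intro sum.mono_neutral_cong_left) auto
    \<comment> \<open>The coefficients of the relation that expresses that \<open>d\<close> is twice an integer combination of \<open>\<sigma>\<close>.\<close>
    define w where "w r = of_bool (r \<in> J) - of_bool (r \<in> K) - 2 * u (\<sigma> r)" for r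
    have "d - 2 *\<^sub>R ((1/2) *\<^sub>R d) = (\<Sum>r\<in>{1..n}. of_int (w r) *\<^sub>R \<sigma> r)"
    proof -
      have "of_int (w r) *\<^sub>R \<sigma> r = of_int (of_bool (r \<in> J)) *\<^sub>R \<sigma> r - of_int (of_bool (r \<in> K)) *\<^sub>R \<sigma> r
          - 2 *\<^sub>R (of_int (u (\<sigma> r)) *\<^sub>R \<sigma> r)" for r
        by (simp add: w_def scaleR_diff_left)
      then have "(\<Sum>r\<in>{1..n}. of_int (w r) *\<^sub>R \<sigma> r) = sum \<sigma> J - sum \<sigma> K - 2 *\<^sub>R ((1/2) *\<^sub>R d)"
        unfolding half ind_sum[OF PowD[OF JK(1)]] ind_sum[OF PowD[OF JK(2)]]
        by (simp only: sum_subtractf scaleR_sum_right)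
      then show ?thesis by (simp add: d_def)
    qed
    then have "(\<Sum>r\<in>{1..n}. of_int (w r) *\<^sub>R \<sigma> r) = 0" by simp
    moreover have "(\<Sum>x\<in>\<sigma> ` {1..n}. of_int (w (inv_into {1..n} \<sigma> x)) *\<^sub>R x)
        = (\<Sum>r\<in>{1..n}. of_int (w r) *\<^sub>R \<sigma> r)"
      by (subst sum.reindex[OF inj], rule sum.cong[OF refl]) (simp only: o_apply inv_into_f_f[OF inj])
    ultimately have zero: "(\<Sum>x\<in>\<sigma> ` {1..n}. of_int (w (inv_into {1..n} \<sigma> x)) *\<^sub>R x) = 0" by simp
    have uu: "of_bool (r \<in> J) - of_bool (r \<in> K) = 2 * u (\<sigma> r)" if "r \<in> {1..n}" for r
      using int_module.independentD[OF nd _ subset_refl zero, of "\<sigma> r"] inv_into_f_f[OF inj that] that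
      by (simp add: w_def)
    have "r \<in> J \<longleftrightarrow> r \<in> K" if "r \<in> {1..n}" for r
    proof -
      have "even (of_bool (r \<in> J) - of_bool (r \<in> K) :: int)" using uu[OF that] by simp
      then show ?thesis by (auto simp: of_bool_def split: if_splits)
    qed
    then show "J = K" using JK by blast
  qed
  then have "card (Pow {1..n}) \<le> card (Pow T)"
    by (rule card_inj_on_le) (use finT in \<open>auto simp: g_def\<close>)
  then have nT: "n \<le> card T" by (simp add: card_Pow finT)
  have cs: "card (\<sigma> ` {1..n}) = n" using inj by (simp add: card_image)
  show ind: "independent (\<sigma> ` {1..n})"
  proof (rule card_le_dim_spanning[of _ U])
    show "\<sigma> ` {1..n} \<subseteq> U" "U \<subseteq> span (\<sigma> ` {1..n})"
      using span(2) span_superset[of "\<sigma> ` {1..n}"] by auto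
    show "card (\<sigma> ` {1..n}) \<le> dim U" using nT dimT cs by simp
  qed simp
  show "n = dim U"
    unfolding span(2)[symmetric] dim_span using dim_eq_card_independent[OF ind] cs by simp
qed

section \<open>Sets of points annihilated by quadratic polynomials\<close>

text \<open>Sets of natural numbers are points with coordinates in the field with two elements, and the
  condition says that the sum over \<open>P\<close> of every monomial of degree at most 2 vanishes. The monomials
  of degree 1 are the case \<open>r = s\<close>.\<close>

definition quadratic_dependency :: "nat set set \<Rightarrow> bool" where
  "quadratic_dependency P \<longleftrightarrow>
     even (card P) \<and> (\<forall>r s. even (card {q \<in> P. r \<in> q \<and> s \<in> q}))"

lemma card_filter_insert:
  assumes "finite P" "p \<notin> P"
  shows "card {q \<in> insert p P. \<phi> q} = of_bool (\<phi> p) + card {q \<in> P. \<phi> q}"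
proof -
  have "{q \<in> insert p P. \<phi> q} = (if \<phi> p then insert p {q \<in> P. \<phi> q} else {q \<in> P. \<phi> q})" by auto
  then show ?thesis using assms by simp
qed

lemma even_card_filter_sym_diff:
  assumes "finite P" "finite Q"
  shows "even (card {q \<in> sym_diff P Q. \<phi> q} + card {q \<in> P. \<phi> q} + card {q \<in> Q. \<phi> q})"
proof -
  let ?A = "{q \<in> P. \<phi> q}" and ?C = "{q \<in> Q. \<phi> q}"
  have fin: "finite ?A" "finite ?C" using assms by auto
  have "{q \<in> sym_diff P Q. \<phi> q} = (?A - ?C) \<union> (?C - ?A)" by auto
  then have h1: "card {q \<in> sym_diff P Q. \<phi> q} = card (?A - ?C) + card (?C - ?A)"
    using fin by (subst card_Un_disjoint[symmetric]) auto
  have h2: "card ?A = card (?A - ?C) + card (?A \<inter> ?C)"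
    using fin by (subst card_Un_disjoint[symmetric]) (auto intro!: arg_cong[where f = card])
  have h3: "card ?C = card (?C - ?A) + card (?A \<inter> ?C)"
    using fin by (subst card_Un_disjoint[symmetric]) (auto intro!: arg_cong[where f = card])
  have "card {q \<in> sym_diff P Q. \<phi> q} + card ?A + card ?C
      = 2 * (card (?A - ?C) + card (?C - ?A) + card (?A \<inter> ?C))"
    unfolding h1 h2 h3 by (simp add: algebra_simps)
  then show ?thesis by (simp only: even_mult_iff even_numeral simp_thms)
qed

lemma two_elements:
  assumes "2 \<le> card q" "x \<in> q"
  obtains y where "y \<in> q" "y \<noteq> x"
proof -
  have "card (q - {x}) \<ge> 1" using assms by (cases "finite q") auto
  then have "q - {x} \<noteq> {}" by (metis card.empty not_one_le_zero)
  then show thesis using that by auto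
qed

text \<open>Monomials \<open>x\<^sub>r x\<^sub>s\<close> with \<open>r \<noteq> s\<close> see only the members with two or more elements, and see each
  of them as the complete graph on its elements. One, two or three distinct complete graphs never
  have empty symmetric difference: for three of them, \<open>A\<close>, \<open>C\<close> and \<open>D\<close>, a vertex \<open>v\<close> of \<open>A\<close> outside \<open>C\<close> forces
  \<open>A \<subseteq> D\<close>, and then an edge of \<open>D\<close> from \<open>v\<close> to a vertex outside \<open>A\<close> lies in \<open>D\<close> only. Once no large
  members are left, the linear monomials exclude the singletons, and the constant one the empty set.\<close>

lemma dependency_few_large_members:
  assumes fin: "finite P" and dep: "quadratic_dependency P"
    and few: "card {q \<in> P. 2 \<le> card q} \<le> 3"
    and finq: "\<And>q. q \<in> P \<Longrightarrow> finite q"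
  shows "P = {}"
proof -
  define H where "H = {q \<in> P. 2 \<le> card q}"
  have finH: "finite H" using fin by (simp add: H_def)
  have big: "2 \<le> card q" if "q \<in> H" for q using that by (simp add: H_def)
  have pair: "even (card {q \<in> H. r \<in> q \<and> s \<in> q})" if "r \<noteq> s" for r s
  proof -
    have "2 \<le> card q" if "q \<in> P" "r \<in> q" "s \<in> q" for q
      using card_mono[of q "{r, s}"] that \<open>r \<noteq> s\<close> finq by auto
    then have "{q \<in> H. r \<in> q \<and> s \<in> q} = {q \<in> P. r \<in> q \<and> s \<in> q}" by (auto simp: H_def)
    then show ?thesis using dep by (simp add: quadratic_dependency_def)
  qed
  have "H = {}"
  proof (rule ccontr)
    assume "H \<noteq> {}"
    then have "card H \<noteq> 0" using finH by simp
    then have "card H = 1 \<or> card H = 2 \<or> card H = 3" using few unfolding H_def by linarith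
    then consider (one) "card H = 1" | (two) "card H = 2" | (three) "card H = 3" by blast
    then show False
    proof cases
      case one
      then obtain A where one: "H = {A}" by (auto simp: card_1_singleton_iff)
      with big have A: "2 \<le> card A" by simp
      then have "A \<noteq> {}" by auto
      then obtain r where "r \<in> A" by blast
      then obtain s where "s \<in> A" "s \<noteq> r" by (rule two_elements[OF A])
      then have "{q \<in> H. r \<in> q \<and> s \<in> q} = {A}" using one \<open>r \<in> A\<close> by auto
      then show False using pair[of r s] \<open>s \<noteq> r\<close> by simp
    next
      case two
      then obtain A C where two: "H = {A, C}" "A \<noteq> C" unfolding card_2_iff by blast
      have count: "card {q \<in> H. \<phi> q} = of_bool (\<phi> A) + of_bool (\<phi> C)" for \<phi>
        unfolding two using two(2) card_filter_insert[of "{C}" A \<phi>] card_filter_insert[of "{}" C \<phi>]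
        by simp
      have eq: "r \<in> A \<and> s \<in> A \<longleftrightarrow> r \<in> C \<and> s \<in> C" if "r \<noteq> s" for r s
        using pair[OF that] unfolding count by (auto simp: of_bool_def split: if_splits)
      have cards: "2 \<le> card A" "2 \<le> card C" using two big by auto
      have sub: "X \<subseteq> Y" if X: "2 \<le> card X"
        and XY: "\<And>r s. r \<noteq> s \<Longrightarrow> r \<in> X \<and> s \<in> X \<Longrightarrow> r \<in> Y \<and> s \<in> Y" for X Y
      proof
        fix r assume r: "r \<in> X"
        then obtain s where "s \<in> X" "s \<noteq> r" by (rule two_elements[OF X])
        then show "r \<in> Y" using r XY[of r s] by blast
      qed
      have "A \<subseteq> C" by (rule sub[OF cards(1)]) (simp add: eq)
      moreover have "C \<subseteq> A" by (rule sub[OF cards(2)]) (simp add: eq)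
      ultimately show False using two by simp
    next
      case three
      then obtain A C D where three: "H = {A, C, D}" "A \<noteq> C" "A \<noteq> D" "C \<noteq> D"
        unfolding card_3_iff by blast
      have count: "card {q \<in> H. \<phi> q} = of_bool (\<phi> A) + of_bool (\<phi> C) + of_bool (\<phi> D)" for \<phi>
        unfolding three using three(2-4) card_filter_insert[of "{C, D}" A \<phi>]
          card_filter_insert[of "{D}" C \<phi>] card_filter_insert[of "{}" D \<phi>]
        by simp
      have eq: "((r \<in> A \<and> s \<in> A) \<noteq> (r \<in> C \<and> s \<in> C)) = (r \<in> D \<and> s \<in> D)" if "r \<noteq> s" for r s
        using pair[OF that] unfolding count by (auto simp: of_bool_def split: if_splits)
      have eq': "((r \<in> C \<and> s \<in> C) \<noteq> (r \<in> A \<and> s \<in> A)) = (r \<in> D \<and> s \<in> D)" if "r \<noteq> s" for r s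
        using eq[OF that] by argo
      have cards: "2 \<le> card A" "2 \<le> card C" using three big by auto
      have no: False if XY: "X \<noteq> D" "2 \<le> card X" "v \<in> X" "v \<notin> Y"
        "\<And>r s. r \<noteq> s \<Longrightarrow> ((r \<in> X \<and> s \<in> X) \<noteq> (r \<in> Y \<and> s \<in> Y)) = (r \<in> D \<and> s \<in> D)" for X Y v
      proof -
        have XD: "x \<in> D" if "x \<in> X" "x \<noteq> v" for x using XY(3,4) XY(5)[of v x] that by blast
        obtain y where "y \<in> X" "y \<noteq> v" using two_elements[OF XY(2,3)] .
        then have "v \<in> D" using XY(3,4) XY(5)[of v y] by blast
        with XD have "X \<subseteq> D" by blast
        with XY(1) obtain w where "w \<in> D" "w \<notin> X" by blast
        then show False using \<open>v \<in> D\<close> XY(3,4) XY(5)[of v w] by blast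
      qed
      from three(2) obtain v where "v \<in> A \<and> v \<notin> C \<or> v \<in> C \<and> v \<notin> A" by blast
      then show False
      proof
        assume "v \<in> A \<and> v \<notin> C"
        then show False using no[of A v C, OF three(3) cards(1) _ _ eq] by blast
      next
        assume "v \<in> C \<and> v \<notin> A"
        then show False using no[of C v A, OF three(4) cards(2) _ _ eq'] by blast
      qed
    qed
  qed
  then have small: "card q < 2" if "q \<in> P" for q using that by (force simp: H_def)
  have sing: "q = {r}" if "q \<in> P" "r \<in> q" for q r
  proof -
    have "card q \<noteq> 0" using that finq by auto
    then have "card q = 1" using small[OF that(1)] by linarith
    then show ?thesis using that(2) by (auto simp: card_1_singleton_iff)
  qed
  have "r \<notin> q" if "q \<in> P" for q r
  proof
    assume "r \<in> q"
    then have "{q \<in> P. r \<in> q \<and> r \<in> q} = {{r}}" using sing that by blast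
    then have "card {q \<in> P. r \<in> q \<and> r \<in> q} = 1" by simp
    moreover have "even (card {q \<in> P. r \<in> q \<and> r \<in> q})"
      using dep unfolding quadratic_dependency_def by blast
    ultimately show False by simp
  qed
  then have "P \<subseteq> {{}}" by blast
  moreover have "P \<noteq> {{}}" using dep by (auto simp: quadratic_dependency_def)
  ultimately show ?thesis by blast
qed

text \<open>The eight membership conditions are equivalent to each other: the monomials of degree 2
  compare the pairs with the full set, those of degree 1 then add the singletons, and the constant adds the
  empty set.\<close>

lemma dependency_three_variables:
  assumes P: "P \<subseteq> Pow {1..3}" and dep: "quadratic_dependency P" and "P \<noteq> {}"
  shows "P = Pow {1..3}"
proof -
  have Pow: "Pow {1..3::nat} = {{}, {1}, {2}, {3}, {1,2}, {1,3}, {2,3}, {1,2,3}}"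
  proof -
    have "{1..3::nat} = {1,2,3}" by auto
    then show ?thesis by (auto simp: Pow_insert)
  qed
  have count: "card {q \<in> P. \<phi> q} = (\<Sum>q\<in>Pow {1..3}. of_bool (q \<in> P \<and> \<phi> q))" for \<phi>
  proof -
    have "{q \<in> P. \<phi> q} = {q \<in> Pow {1..3}. q \<in> P \<and> \<phi> q}" using P by auto
    then show ?thesis by (simp add: sum_of_bool_eq Int_def)
  qed
  have distinct: "(1::nat) \<noteq> 2" "(1::nat) \<noteq> 3" "(2::nat) \<noteq> 3" by auto
  have sum8: "(\<Sum>q\<in>Pow {1..3}. g q) = g {} + g {1} + g {2} + g {3} + g {1,2} + g {1,3} + g {2,3} + g {1,2,3}"
    for g :: "nat set \<Rightarrow> nat"
    unfolding Pow by (simp add: doubleton_eq_iff insert_eq_iff)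
  have "even (card {q \<in> P. True})" using dep by (simp add: quadratic_dependency_def)
  then have all: "even (\<Sum>q\<in>Pow {1..3}. of_bool (q \<in> P \<and> True) :: nat)" by (simp only: count)
  have ev: "even (\<Sum>q\<in>Pow {1..3}. of_bool (q \<in> P \<and> r \<in> q \<and> s \<in> q) :: nat)" for r s
    using dep unfolding quadratic_dependency_def count[symmetric] by blast
  have "{1,2} \<in> P \<longleftrightarrow> {1,2,3} \<in> P" "{1,3} \<in> P \<longleftrightarrow> {1,2,3} \<in> P" "{2,3} \<in> P \<longleftrightarrow> {1,2,3} \<in> P"
    using ev[of 1 2] ev[of 1 3] ev[of 2 3] unfolding sum8 by (auto simp: of_bool_def split: if_splits)
  moreover from this have "{1} \<in> P \<longleftrightarrow> {1,2,3} \<in> P" "{2} \<in> P \<longleftrightarrow> {1,2,3} \<in> P" "{3} \<in> P \<longleftrightarrow> {1,2,3} \<in> P"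
    using ev[of 1 1] ev[of 2 2] ev[of 3 3] unfolding sum8 by (auto simp: of_bool_def split: if_splits)
  moreover from calculation have "{} \<in> P \<longleftrightarrow> {1,2,3} \<in> P"
    using all unfolding sum8 by (auto simp: of_bool_def split: if_splits)
  ultimately have "q \<in> P \<longleftrightarrow> {1,2,3} \<in> P" if "q \<in> Pow {1..3}" for q
    using that unfolding Pow by auto
  then show ?thesis using P \<open>P \<noteq> {}\<close> by blast
qed

section \<open>Groups generated by reflections\<close>

lemma GL_mult:
  assumes "g \<in> carrier (GL X)" "h \<in> carrier (GL X)"
  shows "g \<otimes>\<^bsub>GL X\<^esub> h = compose X g h"
  using assms by (simp add: GL_def BijGroup_def)

lemma GL_one: "\<one>\<^bsub>GL X\<^esub> = (\<lambda>x\<in>X. x)"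
  by (simp add: GL_def BijGroup_def)

lemma GL_carrier_iff:
  "g \<in> carrier (GL X) \<longleftrightarrow> g \<in> Bij X \<and> (\<forall>x\<in>X. \<forall>y\<in>X. g (x + y) = g x + g y) \<and>
     (\<forall>a. \<forall>x\<in>X. g (a *\<^sub>R x) = a *\<^sub>R g x)"
  by (simp add: GL_def BijGroup_def)

text \<open>A generated group is closed under the inverses of its generators; for reflections this adds nothing.\<close>

lemma inv_GL_involution:
  assumes g: "g \<in> carrier (GL X)" and gg: "compose X g g = (\<lambda>x\<in>X. x)"
  shows "inv\<^bsub>GL X\<^esub> g = g"
  unfolding m_inv_def
proof (rule the_equality)
  show "g \<in> carrier (GL X) \<and> g \<otimes>\<^bsub>GL X\<^esub> g = \<one>\<^bsub>GL X\<^esub> \<and> g \<otimes>\<^bsub>GL X\<^esub> g = \<one>\<^bsub>GL X\<^esub>"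
    using g gg by (simp add: GL_mult GL_one)
next
  fix y assume y: "y \<in> carrier (GL X) \<and> g \<otimes>\<^bsub>GL X\<^esub> y = \<one>\<^bsub>GL X\<^esub> \<and> y \<otimes>\<^bsub>GL X\<^esub> g = \<one>\<^bsub>GL X\<^esub>"
  then have yg: "compose X y g = (\<lambda>x\<in>X. x)" using GL_mult[of y X g] g by (simp add: GL_one)
  show "y = g"
  proof (rule extensionalityI[of _ X])
    show "y \<in> extensional X" "g \<in> extensional X"
      using y g by (auto simp: GL_carrier_iff Bij_def)
    fix x assume x: "x \<in> X"
    then have gx: "g x \<in> X" using g by (auto simp: GL_carrier_iff Bij_def bij_betw_def)
    have "g (g x) = x" using fun_cong[OF gg, of x] x by (simp add: compose_def)
    moreover have "y (g (g x)) = g x" using fun_cong[OF yg, of "g x"] gx by (simp add: compose_def)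
    ultimately show "y x = g x" by simp
  qed
qed

lemma mem_hyp_space [simp]: "(v, f) \<in> hyp_space W \<longleftrightarrow> (\<forall>x\<in>W. blinfun_apply f x = 0)"
  by (simp add: hyp_space_def)

lemma hyp_space_closed:
  "x \<in> hyp_space W \<Longrightarrow> y \<in> hyp_space W \<Longrightarrow> x + y \<in> hyp_space W"
  "x \<in> hyp_space W \<Longrightarrow> a *\<^sub>R x \<in> hyp_space W"
  by (cases x; cases y; simp add: blinfun.add_left blinfun.scaleR_left)+

locale hyperbolic_reflections =
  fixes B :: "'v::euclidean_space \<Rightarrow> 'v \<Rightarrow> real" and W :: "'v set"
  assumes bil: "bilinear B" and sym: "B x y = B y x"
begin

lemma B_simps:
  "B (x + y) z = B x z + B y z" "B x (y + z) = B x y + B x z"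
  "B (x - y) z = B x z - B y z" "B x (y - z) = B x y - B x z"
  "B (a *\<^sub>R x) z = a * B x z" "B x (a *\<^sub>R z) = a * B x z"
  "B (- x) z = - B x z" "B x (- z) = - B x z" "B 0 z = 0" "B x 0 = 0"
  using bil by (simp_all add: bilinear_ladd bilinear_radd bilinear_lsub bilinear_rsub
      bilinear_lmul bilinear_rmul bilinear_lneg bilinear_rneg bilinear_lzero bilinear_rzero)

text \<open>The multiple of \<open>\<alpha>\<close> that the reflection subtracts from the vector part \<open>v\<close>. The functional part
  \<open>f\<close> is never changed, so it acts as a parameter.\<close>

definition coeff :: "'v \<Rightarrow> ('v \<Rightarrow>\<^sub>L real) \<Rightarrow> 'v \<Rightarrow> real" where
  "coeff \<alpha> f v = 2 / B \<alpha> \<alpha> * (B v \<alpha> + f \<alpha>)"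

lemma reflection_apply:
  assumes "(v, f) \<in> hyp_space W"
  shows "reflection B W \<alpha> (v, f) = (v - coeff \<alpha> f v *\<^sub>R \<alpha>, f)"
proof -
  have "hyp_form B (v, f) (coroot B \<alpha>, 0) = coeff \<alpha> f v"
    by (simp add: hyp_form_def coroot_def coeff_def B_simps blinfun.scaleR_right
        ring_distribs add_divide_distrib)
  then show ?thesis using assms by (simp add: reflection_def)
qed

lemma coeff_add: "coeff \<alpha> (f + g) (v + w) = coeff \<alpha> f v + coeff \<alpha> g w"
  by (simp add: coeff_def blinfun.add_left B_simps ring_distribs add_divide_distrib)

lemma coeff_scaleR: "coeff \<alpha> (a *\<^sub>R f) (a *\<^sub>R v) = a * coeff \<alpha> f v"
  by (simp add: coeff_def blinfun.scaleR_left B_simps algebra_simps add_divide_distrib)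

lemma reflection_maps: "u \<in> hyp_space W \<Longrightarrow> reflection B W \<alpha> u \<in> hyp_space W"
  by (cases u) (simp add: reflection_apply)

lemma reflection_reflection:
  assumes "B \<alpha> \<alpha> \<noteq> 0" "u \<in> hyp_space W"
  shows "reflection B W \<alpha> (reflection B W \<alpha> u) = u"
proof (cases u)
  case (Pair v f)
  have "coeff \<alpha> f (v - coeff \<alpha> f v *\<^sub>R \<alpha>) = - coeff \<alpha> f v"
    using assms(1) unfolding coeff_def B_simps by (simp add: field_simps)
  then show ?thesis using assms(2) Pair by (simp add: reflection_apply)
qed

lemma reflection_in_GL:
  assumes "B \<alpha> \<alpha> \<noteq> 0"
  shows "reflection B W \<alpha> \<in> carrier (GL (hyp_space W))"
proof -
  have "bij_betw (reflection B W \<alpha>) (hyp_space W) (hyp_space W)"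
    by (rule bij_betw_byWitness[where f' = "reflection B W \<alpha>"])
      (use reflection_reflection[OF assms] reflection_maps in auto)
  moreover have "reflection B W \<alpha> \<in> extensional (hyp_space W)"
    by (simp add: reflection_def)
  moreover have "reflection B W \<alpha> (x + y) = reflection B W \<alpha> x + reflection B W \<alpha> y"
    if "x \<in> hyp_space W" "y \<in> hyp_space W" for x y
    using that by (cases x; cases y)
      (simp add: reflection_apply blinfun.add_left coeff_add scaleR_add_left)
  moreover have "reflection B W \<alpha> (a *\<^sub>R x) = a *\<^sub>R reflection B W \<alpha> x"
    if "x \<in> hyp_space W" for a x
    using that by (cases x)
      (simp add: reflection_apply blinfun.scaleR_left coeff_scaleR scaleR_diff_right)
  ultimately show ?thesis by (simp add: GL_carrier_iff Bij_def)
qed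

definition reflection_group :: "'v set \<Rightarrow> ('v \<times> ('v \<Rightarrow>\<^sub>L real) \<Rightarrow> 'v \<times> ('v \<Rightarrow>\<^sub>L real)) set" where
  "reflection_group A = generate (GL (hyp_space W)) (reflection B W ` A)"

lemma reflection_group_induct_carrier:
  assumes w: "w \<in> reflection_group A" and A: "\<And>\<alpha>. \<alpha> \<in> A \<Longrightarrow> B \<alpha> \<alpha> \<noteq> 0"
    and one: "Q (\<lambda>u\<in>hyp_space W. u)"
    and refl: "\<And>\<alpha>. \<alpha> \<in> A \<Longrightarrow> Q (reflection B W \<alpha>)"
    and comp: "\<And>g h. g \<in> reflection_group A \<Longrightarrow> h \<in> reflection_group A \<Longrightarrow>
      g ` hyp_space W \<subseteq> hyp_space W \<Longrightarrow> h ` hyp_space W \<subseteq> hyp_space W \<Longrightarrow>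
      Q g \<Longrightarrow> Q h \<Longrightarrow> Q (compose (hyp_space W) g h)"
  shows "Q w \<and> w \<in> carrier (GL (hyp_space W))"
  using w unfolding reflection_group_def
proof (induction rule: generate.induct)
  case one
  have "(\<lambda>u\<in>hyp_space W. u) \<in> carrier (GL (hyp_space W))"
    unfolding GL_carrier_iff using id_Bij by (simp add: hyp_space_closed)
  then show ?case using assms(3) unfolding GL_one by blast
next
  case (incl h)
  then show ?case using refl A reflection_in_GL by auto
next
  case (inv h)
  then obtain \<alpha> where \<alpha>: "\<alpha> \<in> A" "h = reflection B W \<alpha>" by auto
  have "compose (hyp_space W) h h = (\<lambda>x\<in>hyp_space W. x)"
    unfolding \<alpha>(2) compose_def using reflection_reflection[OF A[OF \<alpha>(1)]]
    by (intro restrict_ext) auto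
  then have "inv\<^bsub>GL (hyp_space W)\<^esub> h = h"
    using inv_GL_involution reflection_in_GL[OF A[OF \<alpha>(1)]] \<alpha>(2) by blast
  then show ?case using refl A reflection_in_GL \<alpha> by auto
next
  case (eng g h)
  then have gh: "g \<in> carrier (GL (hyp_space W))" "h \<in> carrier (GL (hyp_space W))" "Q g" "Q h" by auto
  have maps: "k ` hyp_space W \<subseteq> hyp_space W" if "k \<in> carrier (GL (hyp_space W))" for k
    using that by (auto simp: GL_carrier_iff Bij_def bij_betw_def)
  have "compose (hyp_space W) g h \<in> carrier (GL (hyp_space W))"
    using gh(1,2) maps[OF gh(2)] compose_Bij[of g "hyp_space W" h]
    by (auto simp: GL_carrier_iff compose_def hyp_space_closed image_subset_iff)
  moreover have "Q (compose (hyp_space W) g h)"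
    by (rule comp) (use eng gh maps in \<open>auto simp: reflection_group_def\<close>)
  ultimately show ?case using gh by (simp add: GL_mult)
qed

lemma reflection_in_group: "\<alpha> \<in> A \<Longrightarrow> reflection B W \<alpha> \<in> reflection_group A"
  by (simp add: reflection_group_def generate.incl)

lemma reflection_group_carrier:
  assumes "w \<in> reflection_group A" "\<And>\<alpha>. \<alpha> \<in> A \<Longrightarrow> B \<alpha> \<alpha> \<noteq> 0"
  shows "w \<in> carrier (GL (hyp_space W))"
  using reflection_group_induct_carrier[of w A "\<lambda>_. True"] assms by blast

lemma reflection_group_induct [consumes 1, case_names nonisotropic one reflection compose]:
  assumes "w \<in> reflection_group A" and "\<And>\<alpha>. \<alpha> \<in> A \<Longrightarrow> B \<alpha> \<alpha> \<noteq> 0"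
    and "Q (\<lambda>u\<in>hyp_space W. u)"
    and "\<And>\<alpha>. \<alpha> \<in> A \<Longrightarrow> Q (reflection B W \<alpha>)"
    and "\<And>g h. g \<in> reflection_group A \<Longrightarrow> h \<in> reflection_group A \<Longrightarrow>
      g ` hyp_space W \<subseteq> hyp_space W \<Longrightarrow> h ` hyp_space W \<subseteq> hyp_space W \<Longrightarrow>
      Q g \<Longrightarrow> Q h \<Longrightarrow> Q (compose (hyp_space W) g h)"
  shows "Q w"
  using reflection_group_induct_carrier[of w A Q] assms by blast

lemma reflection_group_compose:
  assumes "g \<in> reflection_group A" "h \<in> reflection_group A" "\<And>\<alpha>. \<alpha> \<in> A \<Longrightarrow> B \<alpha> \<alpha> \<noteq> 0"
  shows "compose (hyp_space W) g h \<in> reflection_group A"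
  using generate.eng[of g "GL (hyp_space W)" "reflection B W ` A" h] assms
    reflection_group_carrier[of g A] reflection_group_carrier[of h A]
  by (simp add: reflection_group_def GL_mult)

lemma reflection_group_subset:
  assumes C: "\<And>\<alpha>. \<alpha> \<in> C \<Longrightarrow> reflection B W \<alpha> \<in> reflection_group A"
    and A: "\<And>\<alpha>. \<alpha> \<in> A \<Longrightarrow> B \<alpha> \<alpha> \<noteq> 0" and C0: "\<And>\<alpha>. \<alpha> \<in> C \<Longrightarrow> B \<alpha> \<alpha> \<noteq> 0"
  shows "reflection_group C \<subseteq> reflection_group A"
proof
  fix w assume "w \<in> reflection_group C"
  then show "w \<in> reflection_group A"
  proof (induction rule: reflection_group_induct)
    case one
    show ?case unfolding reflection_group_def GL_one[symmetric] by (rule generate.one)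
  next
    case (compose g h)
    then show ?case using reflection_group_compose A by blast
  qed (use C C0 in auto)
qed

text \<open>In terms of translations, the product of reflections with shifts \<open>\<sigma>\<close>, \<open>0\<close>, \<open>\<tau>\<close>, \<open>\<sigma> + \<tau>\<close> is a central
  element given by the exterior product of \<open>\<sigma>\<close> and \<open>\<tau>\<close>. Adding \<open>\<rho>\<close> to all four shifts does not change
  it, and the resulting equation between two products of four is solved for the reflection in \<open>\<beta>\<close>.\<close>

lemma eight_reflections:
  assumes \<beta>: "B \<beta> \<beta> \<noteq> 0" and rad: "\<And>x y. x \<in> {\<rho>, \<sigma>, \<tau>} \<Longrightarrow> B x y = 0" and u: "u \<in> hyp_space W"
  defines "r \<equiv> \<lambda>x. reflection B W (\<beta> + x)"
  shows "r 0 u = r \<sigma> (r (\<rho> + \<sigma>) (r \<rho> (r (\<rho> + \<tau>) (r (\<rho> + \<sigma> + \<tau>) (r (\<sigma> + \<tau>) (r \<tau> u))))))"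
proof (cases u)
  case (Pair v f)
  have f: "(v', f) \<in> hyp_space W" for v' using u Pair by simp
  define c where "c = B \<beta> \<beta>"
  have "c \<noteq> 0" using \<beta> by (simp add: c_def)
  define Rad where "Rad = {x. \<forall>y. B x y = 0}"
  have Rad: "\<rho> \<in> Rad" "\<sigma> \<in> Rad" "\<tau> \<in> Rad" "0 \<in> Rad" and add: "\<And>x y. x \<in> Rad \<Longrightarrow> y \<in> Rad \<Longrightarrow> x + y \<in> Rad"
    using rad by (auto simp: Rad_def B_simps)
  \<comment> \<open>The multiple subtracted in each step depends on \<open>v\<close> only through \<open>m v\<close>, which is affine in this multiple; so
    the claim is linear algebra in the coefficients of \<open>\<beta>\<close>, \<open>\<rho>\<close>, \<open>\<sigma>\<close>, \<open>\<tau>\<close>.\<close>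
  define m where "m v = 2 / c * (B v \<beta> + f \<beta>)" for v
  have step: "r x (v, f) = (v - (m v + 2 / c * f x) *\<^sub>R (\<beta> + x), f)" if "x \<in> Rad" for x v
  proof -
    have "B x y = 0" "B y x = 0" for y using that sym by (auto simp: Rad_def)
    then have "coeff (\<beta> + x) f v = m v + 2 / c * f x"
      unfolding coeff_def m_def
      by (simp add: B_simps blinfun.add_right c_def ring_distribs add_divide_distrib)
    then show ?thesis unfolding r_def reflection_apply[OF f] by simp
  qed
  have m: "m (v - k *\<^sub>R (\<beta> + x)) = m v - 2 * k" if "x \<in> Rad" for x v k
    using that \<open>c \<noteq> 0\<close> unfolding m_def by (simp add: B_simps Rad_def c_def[symmetric] field_simps)
  define a where "a x = 2 / c * f x" for x
  have a: "a (x + y) = a x + a y" "a 0 = 0" for x y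
    by (simp_all add: a_def blinfun.add_right blinfun.zero_right algebra_simps)
  note step' = step[folded a_def]
  have double: "(k * 2) *\<^sub>R x = k *\<^sub>R x + k *\<^sub>R x" for k and x :: 'v
    by (simp flip: scaleR_add_left)
  show ?thesis unfolding Pair
    by (simp add: step' m a Rad add) (simp add: algebra_simps double)
qed

end

section \<open>Affine roots of type B and their parity classes\<close>

text \<open>The functional \<open>e r\<close> reads off the coordinate at \<open>\<sigma> r\<close> and vanishes on the finite part and on
  \<open>S2\<close>. Its multiples are elements of the dual part of the hyperbolic space.\<close>

locale type_B_frame = hyperbolic_reflections B W
  for B :: "'v::euclidean_space \<Rightarrow> 'v \<Rightarrow> real" and W :: "'v set" +
  fixes l :: nat and \<epsilon> :: "nat \<Rightarrow> 'v" and c :: real and S1 S2 :: "'v set"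
    and n :: nat and \<sigma> :: "nat \<Rightarrow> 'v" and e :: "nat \<Rightarrow> 'v \<Rightarrow>\<^sub>L real"
  assumes l3: "3 \<le> l" and c_pos: "c > 0"
    and orth: "\<And>i j. i \<in> {1..l} \<Longrightarrow> j \<in> {1..l} \<Longrightarrow> B (\<epsilon> i) (\<epsilon> j) = (if i = j then c else 0)"
    and eps_W: "\<And>i. i \<in> {1..l} \<Longrightarrow> \<epsilon> i \<in> W"
    and rad1: "\<And>x z. x \<in> zspan S1 \<Longrightarrow> B x z = 0" and rad2: "\<And>y z. y \<in> S2 \<Longrightarrow> B y z = 0"
    and S1_zero: "0 \<in> S1" and S1_double: "\<And>x y. x \<in> S1 \<Longrightarrow> y \<in> zspan S1 \<Longrightarrow> x + 2 *\<^sub>R y \<in> S1"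
    and S2_zspan: "zspan S2 = S2"
    and \<sigma>_span: "zspan (\<sigma> ` {1..n}) = zspan S1"
    and e_W: "\<And>r x. r \<in> {1..n} \<Longrightarrow> x \<in> W \<Longrightarrow> e r x = 0"
    and e_S2: "\<And>r x. r \<in> {1..n} \<Longrightarrow> x \<in> S2 \<Longrightarrow> e r x = 0"
    and e_\<sigma>: "\<And>r s. r \<in> {1..n} \<Longrightarrow> s \<in> {1..n} \<Longrightarrow> e r (\<sigma> s) = (if r = s then 1 else 0)"
begin

lemma rad_right: "x \<in> zspan S1 \<Longrightarrow> B z x = 0" "y \<in> S2 \<Longrightarrow> B z y = 0"
  using rad1 rad2 sym by metis+

lemma S1_zspan: "x \<in> S1 \<Longrightarrow> x \<in> zspan S1"
  by (rule int_module.span_base)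

lemma S2_closed: "0 \<in> S2" "x \<in> S2 \<Longrightarrow> y \<in> S2 \<Longrightarrow> x + y \<in> S2" "x \<in> S2 \<Longrightarrow> y \<in> S2 \<Longrightarrow> x - y \<in> S2"
  using int_module.span_zero[of S2] int_module.span_add[of x S2 y] int_module.span_diff[of x S2 y]
  unfolding S2_zspan by auto

lemma e_Ints:
  assumes "r \<in> {1..n}" "x \<in> zspan S1"
  shows "e r x \<in> \<int>"
  using assms(2) unfolding \<sigma>_span[symmetric]
  by (rule blinfun_zspan_Ints) (use e_\<sigma>[OF assms(1)] in auto)

lemma e_floor: "r \<in> {1..n} \<Longrightarrow> x \<in> zspan S1 \<Longrightarrow> e r x = of_int \<lfloor>e r x\<rfloor>"
  using e_Ints by (auto elim: Ints_cases)

lemma e_sum_\<sigma>: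
  assumes "r \<in> {1..n}" "J \<subseteq> {1..n}"
  shows "e r (sum \<sigma> J) = of_bool (r \<in> J)"
proof -
  have "finite J" using assms(2) by (rule finite_subset) simp
  have "e r (sum \<sigma> J) = (\<Sum>s\<in>J. if r = s then 1 else 0)"
    unfolding blinfun.sum_right using assms by (intro sum.cong) (auto simp: e_\<sigma> subset_iff)
  then show ?thesis using \<open>finite J\<close> by simp
qed

lemma coordinate_expansion:
  assumes "x \<in> zspan S1"
  shows "x = (\<Sum>r\<in>{1..n}. e r x *\<^sub>R \<sigma> r)"
  using assms unfolding \<sigma>_span[symmetric]
proof (induction rule: int_module.span_induct_alt)
  case base
  then show ?case by (simp add: blinfun.zero_right)
next
  case (step m b y)
  then obtain s where s: "s \<in> {1..n}" "b = \<sigma> s" by auto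
  have "(\<Sum>r\<in>{1..n}. e r (of_int m *\<^sub>R b + y) *\<^sub>R \<sigma> r)
      = (\<Sum>r\<in>{1..n}. (of_int m * e r b) *\<^sub>R \<sigma> r) + (\<Sum>r\<in>{1..n}. e r y *\<^sub>R \<sigma> r)"
    by (simp add: blinfun.add_right blinfun.scaleR_right scaleR_add_left sum.distrib)
  also have "(\<Sum>r\<in>{1..n}. (of_int m * e r b) *\<^sub>R \<sigma> r) = (\<Sum>r\<in>{1..n}. if r = s then of_int m *\<^sub>R \<sigma> r else 0)"
    using s e_\<sigma> by (intro sum.cong) auto
  also have "\<dots> = of_int m *\<^sub>R b" using s by simp
  finally show ?case using step by simp
qed

text \<open>Parities of coordinates are a complete invariant of the cosets of twice the integer span.\<close>

lemma same_parity_imp_congruent: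
  assumes "x \<in> zspan S1" "y \<in> zspan S1"
    and even: "\<And>r. r \<in> {1..n} \<Longrightarrow> even (\<lfloor>e r x\<rfloor> - \<lfloor>e r y\<rfloor>)"
  obtains z where "z \<in> zspan S1" "x = y + 2 *\<^sub>R z"
proof
  define z where "z = (\<Sum>r\<in>{1..n}. of_int ((\<lfloor>e r x\<rfloor> - \<lfloor>e r y\<rfloor>) div 2) *\<^sub>R \<sigma> r)"
  show "z \<in> zspan S1"
    unfolding z_def \<sigma>_span[symmetric] by (intro zspan_sum_Ints) (auto intro: int_module.span_base)
  have "2 *\<^sub>R z = (\<Sum>r\<in>{1..n}. e r x *\<^sub>R \<sigma> r) - (\<Sum>r\<in>{1..n}. e r y *\<^sub>R \<sigma> r)"
    unfolding z_def scaleR_sum_right sum_subtractf[symmetric]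
  proof (rule sum.cong[OF refl])
    fix r assume r: "r \<in> {1..n}"
    have "2 * real_of_int ((\<lfloor>e r x\<rfloor> - \<lfloor>e r y\<rfloor>) div 2) = of_int (\<lfloor>e r x\<rfloor> - \<lfloor>e r y\<rfloor>)"
      using even[OF r] by (metis dvd_mult_div_cancel of_int_mult of_int_numeral)
    also have "\<dots> = e r x - e r y" using e_floor[OF r] assms(1,2) by simp
    finally show "2 *\<^sub>R of_int ((\<lfloor>e r x\<rfloor> - \<lfloor>e r y\<rfloor>) div 2) *\<^sub>R \<sigma> r = e r x *\<^sub>R \<sigma> r - e r y *\<^sub>R \<sigma> r"
      by (simp flip: scaleR_diff_left)
  qed
  then show "x = y + 2 *\<^sub>R z"
    using coordinate_expansion[OF assms(1)] coordinate_expansion[OF assms(2)] by simp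
qed

definition long_shifts :: "'v set" where
  "long_shifts = {2 *\<^sub>R x + y |x y. x \<in> zspan S1 \<and> y \<in> S2}"

definition short_affine :: "'v set" where
  "short_affine = {a *\<^sub>R \<epsilon> i + (x + y) |a i x y. a \<in> {1, -1} \<and> i \<in> {1..l} \<and> x \<in> S1 \<and> y \<in> S2}"

definition long_affine :: "'v set" where
  "long_affine = {a *\<^sub>R \<epsilon> i + b *\<^sub>R \<epsilon> j + p |a b i j p.
     a \<in> {1, -1} \<and> b \<in> {1, -1} \<and> i \<in> {1..l} \<and> j \<in> {1..l} \<and> i \<noteq> j \<and> p \<in> long_shifts}"

definition roots :: "'v set" where
  "roots = short_affine \<union> long_affine"

definition parity_class :: "'v \<Rightarrow> nat set" where
  "parity_class \<alpha> = {r \<in> {1..n}. odd \<lfloor>e r \<alpha>\<rfloor>}"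

lemma shift_facts:
  assumes "p \<in> long_shifts"
  shows "B p z = 0" "B z p = 0" "r \<in> {1..n} \<Longrightarrow> \<exists>d::int. e r p = of_int (2 * d)"
proof -
  obtain x y where xy: "x \<in> zspan S1" "y \<in> S2" "p = 2 *\<^sub>R x + y"
    using assms by (auto simp: long_shifts_def)
  show "B p z = 0" "B z p = 0" using xy rad1 rad2 rad_right by (simp_all add: B_simps)
  show "\<exists>d::int. e r p = of_int (2 * d)" if r: "r \<in> {1..n}"
    using e_Ints[OF r xy(1)] e_S2[OF r xy(2)] xy(3)
    by (auto simp: blinfun.add_right blinfun.scaleR_right elim!: Ints_cases)
qed

lemma long_shifts_diff: "p \<in> long_shifts \<Longrightarrow> q \<in> long_shifts \<Longrightarrow> p - q \<in> long_shifts"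
proof -
  assume "p \<in> long_shifts" "q \<in> long_shifts"
  then obtain x y x' y' where "x \<in> zspan S1" "y \<in> S2" "p = 2 *\<^sub>R x + y"
    "x' \<in> zspan S1" "y' \<in> S2" "q = 2 *\<^sub>R x' + y'"
    by (auto simp: long_shifts_def)
  then have "p - q = 2 *\<^sub>R (x - x') + (y - y')" "x - x' \<in> zspan S1" "y - y' \<in> S2"
    using int_module.span_diff S2_closed by (auto simp: algebra_simps)
  then show ?thesis by (auto simp: long_shifts_def)
qed

text \<open>What the reflection in a short root depends on: the index, the sign and the integral coordinates
  of its isotropic part.\<close>

lemma short_affineE:
  assumes "\<alpha> \<in> short_affine"
  obtains a i d where "a = 1 \<or> a = -1" "i \<in> {1..l}" "\<And>v. B v \<alpha> = a * B v (\<epsilon> i)"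
    "\<And>j. j \<in> {1..l} \<Longrightarrow> B \<alpha> (\<epsilon> j) = (if i = j then a * c else 0)" "B \<alpha> \<alpha> = c"
    "\<And>r. r \<in> {1..n} \<Longrightarrow> e r \<alpha> = of_int (d r)" "\<And>r. r \<in> {1..n} \<Longrightarrow> r \<in> parity_class \<alpha> \<longleftrightarrow> odd (d r)"
proof -
  obtain a i x y where \<alpha>: "a = 1 \<or> a = -1" "i \<in> {1..l}" "x \<in> S1" "y \<in> S2" "\<alpha> = a *\<^sub>R \<epsilon> i + (x + y)"
    using assms by (auto simp: short_affine_def)
  note x = S1_zspan[OF \<alpha>(3)]
  have er: "e r \<alpha> = of_int \<lfloor>e r \<alpha>\<rfloor>" if r: "r \<in> {1..n}" for r
  proof -
    have "e r \<alpha> = e r x"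
      using \<alpha>(5) e_S2[OF r \<alpha>(4)] e_W[OF r eps_W[OF \<alpha>(2)]]
      by (simp add: blinfun.add_right blinfun.scaleR_right)
    then show ?thesis using e_floor[OF r x] by simp
  qed
  have 1: "B v \<alpha> = a * B v (\<epsilon> i)" for v
    using x \<alpha>(4,5) by (simp add: B_simps rad_right)
  have 2: "B \<alpha> (\<epsilon> j) = (if i = j then a * c else 0)" if "j \<in> {1..l}" for j
    using x \<alpha>(2,4,5) that orth by (simp add: B_simps rad1 rad2)
  have 3: "B \<alpha> \<alpha> = c" using 1[of \<alpha>] 2[OF \<alpha>(2)] \<alpha>(1) by auto
  show thesis by (rule that[OF \<alpha>(1,2) 1 2 3 er]) (auto simp: parity_class_def)
qed

text \<open>The isotropic part of a long root has even coordinates, whence its empty parity class.\<close>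

lemma long_affineE:
  assumes "\<alpha> \<in> long_affine"
  obtains a b i j d where "a = 1 \<or> a = -1" "b = 1 \<or> b = -1" "i \<in> {1..l}" "j \<in> {1..l}" "i \<noteq> j"
    "\<And>v. B v \<alpha> = a * B v (\<epsilon> i) + b * B v (\<epsilon> j)"
    "\<And>k. k \<in> {1..l} \<Longrightarrow> B \<alpha> (\<epsilon> k) = (if k = i then a * c else if k = j then b * c else 0)"
    "B \<alpha> \<alpha> = 2 * c" "\<And>r. r \<in> {1..n} \<Longrightarrow> e r \<alpha> = of_int (2 * d r)" "parity_class \<alpha> = {}"
proof -
  obtain a b i j p where ab: "a \<in> {1, -1}" "b \<in> {1, -1}" and \<alpha>': "i \<in> {1..l}" "j \<in> {1..l}" "i \<noteq> j"
    "p \<in> long_shifts" "\<alpha> = a *\<^sub>R \<epsilon> i + b *\<^sub>R \<epsilon> j + p"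
    using assms unfolding long_affine_def by blast
  have "a = 1 \<or> a = -1" "b = 1 \<or> b = -1" using ab by auto
  note \<alpha> = this \<alpha>'
  have "\<exists>d::int. e r \<alpha> = of_int (2 * d)" if r: "r \<in> {1..n}" for r
    using shift_facts(3)[OF \<alpha>(6) r] e_W[OF r eps_W] \<alpha>(3,4,7)
    by (simp add: blinfun.add_right blinfun.scaleR_right)
  then obtain d :: "nat \<Rightarrow> int" where d: "\<And>r. r \<in> {1..n} \<Longrightarrow> e r \<alpha> = of_int (2 * d r)" by metis
  have 1: "B v \<alpha> = a * B v (\<epsilon> i) + b * B v (\<epsilon> j)" for v
    using shift_facts[OF \<alpha>(6)] \<alpha>(7) by (simp add: B_simps)
  have 2: "B \<alpha> (\<epsilon> k) = (if k = i then a * c else if k = j then b * c else 0)" if "k \<in> {1..l}" for k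
    using shift_facts[OF \<alpha>(6)] \<alpha> orth that by (auto simp: B_simps)
  have 3: "B \<alpha> \<alpha> = 2 * c" using 1[of \<alpha>] 2[OF \<alpha>(3)] 2[OF \<alpha>(4)] \<alpha>(1,2,5) by auto
  have 4: "parity_class \<alpha> = {}" unfolding parity_class_def using d by (auto simp del: of_int_mult)
  show thesis by (rule that[OF \<alpha>(1-5) 1 2 3 d 4])
qed

lemma roots_nonisotropic: "\<alpha> \<in> roots \<Longrightarrow> B \<alpha> \<alpha> \<noteq> 0"
  unfolding roots_def using c_pos by (auto elim!: short_affineE long_affineE)

text \<open>The isotropic part of a short root lies in \<open>S1\<close> up to \<open>S2\<close>, and reducing its coordinates modulo 2
  does not leave \<open>S1\<close>.\<close>

lemma parity_class_in_supp:
  assumes "\<alpha> \<in> short_affine"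
  shows "parity_class \<alpha> \<in> supp S1 n \<sigma>"
proof -
  obtain a i x y where \<alpha>: "i \<in> {1..l}" "x \<in> S1" "y \<in> S2" "\<alpha> = a *\<^sub>R \<epsilon> i + (x + y)"
    using assms by (auto simp: short_affine_def)
  note x = S1_zspan[OF \<alpha>(2)]
  let ?J = "parity_class \<alpha>"
  have J: "?J \<subseteq> {1..n}" by (auto simp: parity_class_def)
  have er: "e r \<alpha> = e r x" if r: "r \<in> {1..n}" for r
    using \<alpha>(4) e_S2[OF r \<alpha>(3)] e_W[OF r eps_W[OF \<alpha>(1)]]
    by (simp add: blinfun.add_right blinfun.scaleR_right)
  have "sum \<sigma> ?J \<in> zspan S1"
    unfolding \<sigma>_span[symmetric] using J by (intro int_module.span_sum int_module.span_base) auto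
  moreover have "even (\<lfloor>e r (sum \<sigma> ?J)\<rfloor> - \<lfloor>e r x\<rfloor>)" if r: "r \<in> {1..n}" for r
    unfolding e_sum_\<sigma>[OF r J] using er[OF r] r by (cases "r \<in> ?J") (auto simp: parity_class_def)
  ultimately obtain z where "z \<in> zspan S1" "sum \<sigma> ?J = x + 2 *\<^sub>R z"
    using same_parity_imp_congruent[OF _ x] by blast
  then show ?thesis using S1_double[OF \<alpha>(2)] J by (simp add: supp_def)
qed

section \<open>Invariants modulo 2 of the Weyl group\<close>

text \<open>A domain stable under all reflections when the functional is \<open>c *\<^sub>R e r\<close>; on it the coordinates are
  even, so that their halves can be compared modulo 2.\<close>

definition integral_states :: "'v set" where
  "integral_states = {v. (\<forall>i\<in>{1..l}. \<exists>m::int. B v (\<epsilon> i) = 2 * c * of_int m) \<and>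
     (\<forall>s\<in>{1..n}. \<exists>m::int. e s v = 2 * of_int m)}"

definition half_coord :: "nat \<Rightarrow> 'v \<Rightarrow> int" where
  "half_coord s v = \<lfloor>e s v / 2\<rfloor>"

definition sign_states :: "'v set" where
  "sign_states = {v. \<forall>i\<in>{1..l}. B v (\<epsilon> i) = c \<or> B v (\<epsilon> i) = - c}"

definition sign_product :: "'v \<Rightarrow> real" where
  "sign_product v = (\<Prod>i\<in>{1..l}. B v (\<epsilon> i) / c)"

lemma half_coord_eq: "e s v = 2 * of_int m \<Longrightarrow> half_coord s v = m"
  by (simp add: half_coord_def)

text \<open>For a short root with isotropic coordinates \<open>d\<close>, the reflection subtracts
  \<open>2 (2 a X + d r)\<close> times the root, where \<open>2 c X\<close> is the pairing of the state with \<open>\<epsilon> i\<close>; half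
  of the coordinate at \<open>\<sigma> s\<close> therefore changes by \<open>d r * d s\<close> modulo 2. For a long root both
  the multiple and the coordinates of the root are even.\<close>

lemma integral_step:
  assumes \<alpha>: "\<alpha> \<in> roots" and r: "r \<in> {1..n}" and v: "v \<in> integral_states"
  defines "v' \<equiv> v - coeff \<alpha> (c *\<^sub>R e r) v *\<^sub>R \<alpha>"
  shows "v' \<in> integral_states"
    and "\<And>s. s \<in> {1..n} \<Longrightarrow>
      even (half_coord s v' - half_coord s v - of_bool (r \<in> parity_class \<alpha> \<and> s \<in> parity_class \<alpha>))"
proof -
  obtain X where "\<forall>i\<in>{1..l}. B v (\<epsilon> i) = 2 * c * of_int (X i)"
    using bchoice[of "{1..l}" "\<lambda>i m. B v (\<epsilon> i) = 2 * c * of_int m"] v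
    unfolding integral_states_def by blast
  then have X: "\<And>i. i \<in> {1..l} \<Longrightarrow> B v (\<epsilon> i) = 2 * c * of_int (X i)" by blast
  obtain N where "\<forall>s\<in>{1..n}. e s v = 2 * of_int (N s)"
    using bchoice[of "{1..n}" "\<lambda>s m. e s v = 2 * of_int m"] v
    unfolding integral_states_def by blast
  then have N: "\<And>s. s \<in> {1..n} \<Longrightarrow> e s v = 2 * of_int (N s)" by blast
  have "v' \<in> integral_states \<and> (\<forall>s\<in>{1..n}.
      even (half_coord s v' - half_coord s v - of_bool (r \<in> parity_class \<alpha> \<and> s \<in> parity_class \<alpha>)))"
  proof (cases "\<alpha> \<in> short_affine")
    case True
    then obtain a i d where ai: "a = 1 \<or> a = -1" "i \<in> {1..l}" "\<And>v. B v \<alpha> = a * B v (\<epsilon> i)"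
      "\<And>j. j \<in> {1..l} \<Longrightarrow> B \<alpha> (\<epsilon> j) = (if i = j then a * c else 0)" "B \<alpha> \<alpha> = c"
      and d: "\<And>r. r \<in> {1..n} \<Longrightarrow> e r \<alpha> = of_int (d r)" "\<And>r. r \<in> {1..n} \<Longrightarrow> r \<in> parity_class \<alpha> \<longleftrightarrow> odd (d r)"
      by (rule short_affineE) blast
    obtain a' :: int where a': "a = of_int a'" using ai(1) by (metis of_int_1 of_int_minus)
    define k where "k = 2 * a' * X i + d r"
    have k: "coeff \<alpha> (c *\<^sub>R e r) v = 2 * of_int k"
      unfolding coeff_def unfolding ai(5) unfolding ai(3) X[OF ai(2)]
      using c_pos d(1)[OF r] by (simp add: blinfun.scaleR_left k_def a' field_simps)
    have 1: "B v' (\<epsilon> j) = 2 * c * of_int (X j - (if i = j then a' * k else 0))" if "j \<in> {1..l}" for j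
      unfolding v'_def k using ai(4)[OF that] X[OF that] by (simp add: B_simps a' algebra_simps)
    have 2: "e s v' = 2 * of_int (N s - k * d s)" if "s \<in> {1..n}" for s
      unfolding v'_def k using N[OF that] d(1)[OF that]
      by (simp add: blinfun.diff_right blinfun.scaleR_right algebra_simps)
    have "even (half_coord s v' - half_coord s v - of_bool (r \<in> parity_class \<alpha> \<and> s \<in> parity_class \<alpha>))"
      if s: "s \<in> {1..n}" for s
      unfolding half_coord_eq[OF 2[OF s]] half_coord_eq[OF N[OF s]] d(2)[OF r] d(2)[OF s]
      by (auto simp: k_def)
    moreover have "v' \<in> integral_states" using 1 2 unfolding integral_states_def by blast
    ultimately show ?thesis by blast
  next
    case False
    then have "\<alpha> \<in> long_affine" using \<alpha> by (simp add: roots_def)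
    then obtain a b i j d where ab: "a = 1 \<or> a = -1" "b = 1 \<or> b = -1" "i \<in> {1..l}" "j \<in> {1..l}" "i \<noteq> j"
      "\<And>v. B v \<alpha> = a * B v (\<epsilon> i) + b * B v (\<epsilon> j)"
      "\<And>k. k \<in> {1..l} \<Longrightarrow> B \<alpha> (\<epsilon> k) = (if k = i then a * c else if k = j then b * c else 0)"
      "B \<alpha> \<alpha> = 2 * c" and d: "\<And>r. r \<in> {1..n} \<Longrightarrow> e r \<alpha> = of_int (2 * d r)" "parity_class \<alpha> = {}"
      by (rule long_affineE) blast
    obtain a' b' :: int where a': "a = of_int a'" "b = of_int b'"
      using ab(1,2) by (metis of_int_1 of_int_minus)
    define k where "k = a' * X i + b' * X j + d r"
    have k: "coeff \<alpha> (c *\<^sub>R e r) v = 2 * of_int k"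
      unfolding coeff_def unfolding ab(8) unfolding ab(6) X[OF ab(3)] X[OF ab(4)]
      using c_pos d(1)[OF r] by (simp add: blinfun.scaleR_left k_def a' field_simps)
    have 1: "B v' (\<epsilon> m) = 2 * c * of_int (X m - (if m = i then a' * k else if m = j then b' * k else 0))"
      if "m \<in> {1..l}" for m
      unfolding v'_def k using ab(7)[OF that] X[OF that] by (simp add: B_simps a' algebra_simps)
    have 2: "e s v' = 2 * of_int (N s - 2 * k * d s)" if "s \<in> {1..n}" for s
      unfolding v'_def k using N[OF that] d(1)[OF that]
      by (simp add: blinfun.diff_right blinfun.scaleR_right algebra_simps)
    have "even (half_coord s v' - half_coord s v - of_bool (r \<in> parity_class \<alpha> \<and> s \<in> parity_class \<alpha>))"
      if s: "s \<in> {1..n}" for s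
      unfolding half_coord_eq[OF 2[OF s]] half_coord_eq[OF N[OF s]] d(2) by simp
    moreover have "v' \<in> integral_states" using 1 2 unfolding integral_states_def by blast
    ultimately show ?thesis by blast
  qed
  then show "v' \<in> integral_states"
    "\<And>s. s \<in> {1..n} \<Longrightarrow>
      even (half_coord s v' - half_coord s v - of_bool (r \<in> parity_class \<alpha> \<and> s \<in> parity_class \<alpha>))"
    by blast+
qed

lemma sign_step_short:
  assumes \<alpha>: "\<alpha> \<in> short_affine" and v: "v \<in> sign_states"
  defines "v' \<equiv> v - coeff \<alpha> 0 v *\<^sub>R \<alpha>"
  shows "v' \<in> sign_states" and "sign_product v' = - sign_product v"
proof -
  obtain a i where ai: "a = 1 \<or> a = -1" "i \<in> {1..l}" "\<And>v. B v \<alpha> = a * B v (\<epsilon> i)"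
    "\<And>j. j \<in> {1..l} \<Longrightarrow> B \<alpha> (\<epsilon> j) = (if i = j then a * c else 0)" "B \<alpha> \<alpha> = c"
    using \<alpha> by (rule short_affineE) blast
  have coeff: "coeff \<alpha> 0 v = 2 * a * B v (\<epsilon> i) / c"
    unfolding coeff_def unfolding ai(5) unfolding ai(3) by (simp add: blinfun.zero_left)
  have B': "B v' (\<epsilon> j) = (if i = j then - B v (\<epsilon> j) else B v (\<epsilon> j))" if "j \<in> {1..l}" for j
    unfolding v'_def coeff B_simps ai(4)[OF that] using c_pos ai(1) by auto
  then show "v' \<in> sign_states" using v by (auto simp: sign_states_def)
  have "sign_product v' = (B v' (\<epsilon> i) / c) * (\<Prod>j\<in>{1..l} - {i}. B v' (\<epsilon> j) / c)"
    unfolding sign_product_def by (rule prod.remove) (use ai in auto)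
  also have "\<dots> = - (B v (\<epsilon> i) / c) * (\<Prod>j\<in>{1..l} - {i}. B v (\<epsilon> j) / c)"
    using B' ai(2) by (intro arg_cong2[where f = "(*)"] prod.cong) auto
  also have "\<dots> = - sign_product v"
    unfolding sign_product_def using prod.remove[of "{1..l}" i "\<lambda>j. B v (\<epsilon> j) / c"] ai(2) by simp
  finally show "sign_product v' = - sign_product v" .
qed

text \<open>A long reflection swaps two entries of the sign vector, possibly negating both.\<close>

lemma sign_step_long:
  assumes \<alpha>: "\<alpha> \<in> long_affine" and v: "v \<in> sign_states"
  defines "v' \<equiv> v - coeff \<alpha> 0 v *\<^sub>R \<alpha>"
  shows "v' \<in> sign_states" and "sign_product v' = sign_product v"
proof -
  obtain a b i j where ab: "a = 1 \<or> a = -1" "b = 1 \<or> b = -1" "i \<in> {1..l}" "j \<in> {1..l}" "i \<noteq> j"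
    "\<And>v. B v \<alpha> = a * B v (\<epsilon> i) + b * B v (\<epsilon> j)"
    "\<And>k. k \<in> {1..l} \<Longrightarrow> B \<alpha> (\<epsilon> k) = (if k = i then a * c else if k = j then b * c else 0)"
    "B \<alpha> \<alpha> = 2 * c"
    using \<alpha> by (rule long_affineE) blast
  have coeff: "coeff \<alpha> 0 v = (a * B v (\<epsilon> i) + b * B v (\<epsilon> j)) / c"
    unfolding coeff_def unfolding ab(8) unfolding ab(6) by (simp add: blinfun.zero_left)
  have B': "B v' (\<epsilon> k) = (if k = i then - (a * b) * B v (\<epsilon> j) else if k = j then - (a * b) * B v (\<epsilon> i)
      else B v (\<epsilon> k))" if "k \<in> {1..l}" for k
    unfolding v'_def coeff B_simps ab(7)[OF that] using c_pos ab(1,2) by auto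
  then show "v' \<in> sign_states" using v ab(1-4) by (auto simp: sign_states_def)
  have split: "sign_product u = (B u (\<epsilon> i) / c) * ((B u (\<epsilon> j) / c) * (\<Prod>k\<in>{1..l} - {i} - {j}. B u (\<epsilon> k) / c))" for u
    unfolding sign_product_def
    using prod.remove[of "{1..l}" i "\<lambda>k. B u (\<epsilon> k) / c"]
      prod.remove[of "{1..l} - {i}" j "\<lambda>k. B u (\<epsilon> k) / c"] ab(3-5) by simp
  have "(\<Prod>k\<in>{1..l} - {i} - {j}. B v' (\<epsilon> k) / c) = (\<Prod>k\<in>{1..l} - {i} - {j}. B v (\<epsilon> k) / c)"
    using B' by (intro prod.cong) auto
  then show "sign_product v' = sign_product v"
    unfolding split using B'[OF ab(3)] B'[OF ab(4)] ab(1,2,5) by auto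
qed

text \<open>\<open>P\<close> records modulo 2 the parity classes of the short reflections in a word for \<open>w\<close>; its
  quadratic data can be read off from the action of \<open>w\<close> alone.\<close>

definition tracks :: "('v \<times> ('v \<Rightarrow>\<^sub>L real) \<Rightarrow> 'v \<times> ('v \<Rightarrow>\<^sub>L real)) \<Rightarrow> nat set set \<Rightarrow> bool" where
  "tracks w P \<longleftrightarrow> finite P \<and>
     (\<forall>r\<in>{1..n}. \<forall>v\<in>integral_states. \<exists>v'\<in>integral_states. w (v, c *\<^sub>R e r) = (v', c *\<^sub>R e r) \<and>
        (\<forall>s\<in>{1..n}. even (half_coord s v' - half_coord s v - int (card {q \<in> P. r \<in> q \<and> s \<in> q})))) \<and>
     (\<forall>v\<in>sign_states. \<exists>v'\<in>sign_states. w (v, 0) = (v', 0) \<and>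
        sign_product v' = (-1) ^ card P * sign_product v)"

lemma probe_in_hyp_space: "r \<in> {1..n} \<Longrightarrow> (v, c *\<^sub>R e r) \<in> hyp_space W" "(v, 0) \<in> hyp_space W"
  using e_W by (simp_all add: blinfun.scaleR_left)

lemma tracks_id: "tracks (\<lambda>u\<in>hyp_space W. u) {}"
  unfolding tracks_def using probe_in_hyp_space by auto

lemma tracks_short:
  assumes "\<alpha> \<in> short_affine"
  shows "tracks (reflection B W \<alpha>) {parity_class \<alpha>}"
proof -
  have \<alpha>: "\<alpha> \<in> roots" using assms by (simp add: roots_def)
  have card: "int (card {q \<in> {parity_class \<alpha>}. r \<in> q \<and> s \<in> q})
      = of_bool (r \<in> parity_class \<alpha> \<and> s \<in> parity_class \<alpha>)" for r s
    using card_filter_insert[of "{}" "parity_class \<alpha>"] by simp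
  show ?thesis unfolding tracks_def card
    using integral_step[OF \<alpha>] sign_step_short[OF assms]
    by (auto simp: reflection_apply[OF probe_in_hyp_space(1)] reflection_apply[OF probe_in_hyp_space(2)])
qed

lemma tracks_long:
  assumes "\<alpha> \<in> long_affine"
  shows "tracks (reflection B W \<alpha>) {}"
proof -
  have \<alpha>: "\<alpha> \<in> roots" using assms by (simp add: roots_def)
  have cls: "parity_class \<alpha> = {}" using assms by (rule long_affineE)
  show ?thesis unfolding tracks_def
    using integral_step[OF \<alpha>] sign_step_long[OF assms]
    by (auto simp: cls reflection_apply[OF probe_in_hyp_space(1)] reflection_apply[OF probe_in_hyp_space(2)])
qed

text \<open>Classes that occur in both words cancel modulo 2.\<close>

lemma tracks_compose:
  assumes g: "tracks g P" and h: "tracks h Q"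
  shows "tracks (compose (hyp_space W) g h) (sym_diff P Q)"
  unfolding tracks_def
proof (intro conjI ballI)
  have fin: "finite P" "finite Q" using g h by (auto simp: tracks_def)
  then show "finite (sym_diff P Q)" by simp
  {
    fix r v assume r: "r \<in> {1..n}" and v: "v \<in> integral_states"
    obtain v1 where v1: "v1 \<in> integral_states" "h (v, c *\<^sub>R e r) = (v1, c *\<^sub>R e r)"
      "\<And>s. s \<in> {1..n} \<Longrightarrow> even (half_coord s v1 - half_coord s v - int (card {q \<in> Q. r \<in> q \<and> s \<in> q}))"
      using h r v unfolding tracks_def by blast
    obtain v2 where v2: "v2 \<in> integral_states" "g (v1, c *\<^sub>R e r) = (v2, c *\<^sub>R e r)"
      "\<And>s. s \<in> {1..n} \<Longrightarrow> even (half_coord s v2 - half_coord s v1 - int (card {q \<in> P. r \<in> q \<and> s \<in> q}))"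
      using g r v1(1) unfolding tracks_def by blast
    have "even (half_coord s v2 - half_coord s v - int (card {q \<in> sym_diff P Q. r \<in> q \<and> s \<in> q}))"
      if s: "s \<in> {1..n}" for s
    proof -
      have "even (int (card {q \<in> sym_diff P Q. r \<in> q \<and> s \<in> q}) + int (card {q \<in> P. r \<in> q \<and> s \<in> q})
          + int (card {q \<in> Q. r \<in> q \<and> s \<in> q}))"
        using even_card_filter_sym_diff[OF fin, of "\<lambda>q. r \<in> q \<and> s \<in> q"] by (simp flip: of_nat_add)
      then show ?thesis using v1(3)[OF s] v2(3)[OF s] by presburger
    qed
    then show "\<exists>v'\<in>integral_states. compose (hyp_space W) g h (v, c *\<^sub>R e r) = (v', c *\<^sub>R e r) \<and>
        (\<forall>s\<in>{1..n}. even (half_coord s v' - half_coord s v - int (card {q \<in> sym_diff P Q. r \<in> q \<and> s \<in> q})))"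
      using v1 v2 probe_in_hyp_space(1)[OF r] by (auto simp: compose_def)
  next
    fix v assume v: "v \<in> sign_states"
    obtain v1 where v1: "v1 \<in> sign_states" "h (v, 0) = (v1, 0)"
      "sign_product v1 = (-1) ^ card Q * sign_product v"
      using h v unfolding tracks_def by blast
    obtain v2 where v2: "v2 \<in> sign_states" "g (v1, 0) = (v2, 0)"
      "sign_product v2 = (-1) ^ card P * sign_product v1"
      using g v1(1) unfolding tracks_def by blast
    have "even (card (sym_diff P Q) + card P + card Q)"
      using even_card_filter_sym_diff[OF fin, of "\<lambda>_. True"] by (simp only: simp_thms Collect_mem_eq)
    then have "(-1::real) ^ card (sym_diff P Q) = (-1) ^ card P * (-1) ^ card Q"
      unfolding minus_one_power_iff by (auto split: if_splits)
    then show "\<exists>v'\<in>sign_states. compose (hyp_space W) g h (v, 0) = (v', 0) \<and>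
        sign_product v' = (-1) ^ card (sym_diff P Q) * sign_product v"
      using v1 v2 probe_in_hyp_space(2) by (auto simp: compose_def)
  }
qed

lemma reflection_group_tracks:
  assumes "w \<in> reflection_group A" and A: "A \<subseteq> roots"
  shows "\<exists>P \<subseteq> parity_class ` (A \<inter> short_affine). tracks w P"
  using assms(1)
proof (induction rule: reflection_group_induct)
  case (nonisotropic \<alpha>)
  then show ?case using roots_nonisotropic A by blast
next
  case one
  then show ?case using tracks_id by blast
next
  case (reflection \<alpha>)
  show ?case
  proof (cases "\<alpha> \<in> short_affine")
    case True
    then have "{parity_class \<alpha>} \<subseteq> parity_class ` (A \<inter> short_affine)" using reflection by blast
    then show ?thesis using tracks_short[OF True] by blast
  next
    case False
    then show ?thesis using tracks_long[of \<alpha>] reflection A by (auto simp: roots_def)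
  qed
next
  case (compose g h)
  then obtain P Q where "P \<subseteq> parity_class ` (A \<inter> short_affine)" "tracks g P"
    "Q \<subseteq> parity_class ` (A \<inter> short_affine)" "tracks h Q" by blast
  then show ?case using tracks_compose[of g P h Q] by (intro exI[of _ "sym_diff P Q"]) blast
qed

text \<open>Comparing the two records of the same \<open>w\<close> on the zero vector yields the monomials of degree 1 and
  2, and comparing them on \<open>\<epsilon> 1 + \<dots> + \<epsilon> l\<close> yields the constant.\<close>

lemma tracks_twice_imp_dependency:
  assumes p: "tracks w {p}" and P: "tracks w P" "p \<notin> P" and sub: "\<And>q. q \<in> insert p P \<Longrightarrow> q \<subseteq> {1..n}"
  shows "quadratic_dependency (insert p P)"
proof -
  have fin: "finite P" using P by (simp add: tracks_def)
  have "even (card {q \<in> insert p P. r \<in> q \<and> s \<in> q})" for r s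
  proof (cases "r \<in> {1..n} \<and> s \<in> {1..n}")
    case True
    then have rs: "r \<in> {1..n}" "s \<in> {1..n}" by auto
    have 0: "(0::'v) \<in> integral_states"
      by (auto simp: integral_states_def B_simps blinfun.zero_right intro!: exI[of _ 0])
    obtain v where v: "w (0, c *\<^sub>R e r) = (v, c *\<^sub>R e r)"
      "even (half_coord s v - half_coord s 0 - int (card {q \<in> P. r \<in> q \<and> s \<in> q}))"
      using P(1) 0 rs unfolding tracks_def by blast
    obtain v' where v': "w (0, c *\<^sub>R e r) = (v', c *\<^sub>R e r)"
      "even (half_coord s v' - half_coord s 0 - int (card {q \<in> {p}. r \<in> q \<and> s \<in> q}))"
      using p 0 rs unfolding tracks_def by blast
    have "v' = v" using v(1) v'(1) by simp
    have single: "card {q \<in> {p}. r \<in> q \<and> s \<in> q} = of_bool (r \<in> p \<and> s \<in> p)"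
      using card_filter_insert[of "{}" p "\<lambda>q. r \<in> q \<and> s \<in> q"] by simp
    have parity: "even (a + b)" if "even (h - g - int b)" "even (h - g - int a)" for h g a b
      using that by presburger
    have "even (of_bool (r \<in> p \<and> s \<in> p) + card {q \<in> P. r \<in> q \<and> s \<in> q})"
      by (rule parity[OF v(2) v'(2)[unfolded single \<open>v' = v\<close>]])
    then show ?thesis unfolding card_filter_insert[OF fin P(2)] .
  next
    case False
    then have "{q \<in> insert p P. r \<in> q \<and> s \<in> q} = {}" using sub by blast
    then show ?thesis by (simp only: card.empty even_zero)
  qed
  moreover have "even (card (insert p P))"
  proof -
    let ?v = "\<Sum>i\<in>{1..l}. \<epsilon> i"
    have Bs: "B (\<Sum>i\<in>I. \<epsilon> i) z = (\<Sum>i\<in>I. B (\<epsilon> i) z)" for I z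
      by (induction I rule: infinite_finite_induct) (simp_all add: B_simps)
    have Bv: "B ?v (\<epsilon> j) = c" if "j \<in> {1..l}" for j
    proof -
      have "(\<Sum>i\<in>{1..l}. B (\<epsilon> i) (\<epsilon> j)) = (\<Sum>i\<in>{1..l}. if i = j then c else 0)"
        using that orth by (intro sum.cong) auto
      then show ?thesis unfolding Bs using that by simp
    qed
    then have v: "?v \<in> sign_states" by (auto simp: sign_states_def)
    have "sign_product ?v = 1" using Bv c_pos by (simp add: sign_product_def)
    obtain v1 where v1: "w (?v, 0) = (v1, 0)" "sign_product v1 = (-1) ^ card P * sign_product ?v"
      using P(1) v unfolding tracks_def by blast
    obtain v2 where v2: "w (?v, 0) = (v2, 0)" "sign_product v2 = (-1) ^ card {p} * sign_product ?v"
      using p v unfolding tracks_def by blast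
    have "v1 = v2" using v1(1) v2(1) by simp
    then have "(-1::real) ^ card P = -1" using v1(2) v2(2) \<open>sign_product ?v = 1\<close> by simp
    then have "odd (card P)" by (auto simp: minus_one_power_iff split: if_splits)
    then show ?thesis using fin P(2) by simp
  qed
  ultimately show ?thesis by (simp add: quadratic_dependency_def)
qed

section \<open>Orbits of roots\<close>

definition orbit :: "'v \<Rightarrow> 'v set" where
  "orbit \<alpha> = {\<beta>. \<exists>w\<in>reflection_group roots. w (\<alpha>, 0) = (\<beta>, 0)}"

lemma orbit_trans:
  assumes "\<beta> \<in> orbit \<alpha>" "\<gamma> \<in> orbit \<beta>"
  shows "\<gamma> \<in> orbit \<alpha>"
proof -
  obtain h g where hg: "h \<in> reflection_group roots" "h (\<alpha>, 0) = (\<beta>, 0)"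
    "g \<in> reflection_group roots" "g (\<beta>, 0) = (\<gamma>, 0)"
    using assms by (auto simp: orbit_def)
  then have "compose (hyp_space W) g h \<in> reflection_group roots"
    using reflection_group_compose roots_nonisotropic by blast
  moreover have "compose (hyp_space W) g h (\<alpha>, 0) = (\<gamma>, 0)"
    using hg by (simp add: compose_def)
  ultimately show ?thesis unfolding orbit_def by blast
qed

lemma orbit_long_step:
  assumes \<gamma>: "\<gamma> \<in> long_affine" and "B \<alpha> \<gamma> = c"
  shows "\<alpha> - \<gamma> \<in> orbit \<alpha>"
proof -
  have BB: "B \<gamma> \<gamma> = 2 * c" using \<gamma> by (rule long_affineE)
  have "coeff \<gamma> 0 \<alpha> = 1" unfolding coeff_def BB assms(2) using c_pos by (simp add: blinfun.zero_left)
  then have "reflection B W \<gamma> (\<alpha>, 0) = (\<alpha> - \<gamma>, 0)" by (simp add: reflection_apply)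
  moreover have "reflection B W \<gamma> \<in> reflection_group roots"
    using \<gamma> by (intro reflection_in_group) (simp add: roots_def)
  ultimately show ?thesis unfolding orbit_def by blast
qed

lemma third_index:
  obtains k where "k \<in> {1..l}" "k \<noteq> i" "k \<noteq> j"
proof -
  have "card ({1..l} - {i, j}) \<ge> 1"
    using l3 diff_card_le_card_Diff[of "{i, j}" "{1..l}"] card_insert_le_m1[of 2 "{j}" i] by simp
  then have "{1..l} - {i, j} \<noteq> {}" by (metis card.empty not_one_le_zero)
  then show thesis using that by blast
qed

text \<open>The difference of the two short roots is a long root, and its reflection takes one to the other.\<close>

lemma orbit_short_step:
  assumes a: "a \<in> {1, -1}" "b \<in> {1, -1}" and ij: "i \<in> {1..l}" "j \<in> {1..l}" "i \<noteq> j"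
    and x: "\<And>z. B x z = 0" "\<And>z. B z x = 0" and xy: "x - y \<in> long_shifts"
  shows "b *\<^sub>R \<epsilon> j + y \<in> orbit (a *\<^sub>R \<epsilon> i + x)"
proof -
  let ?\<gamma> = "a *\<^sub>R \<epsilon> i + (- b) *\<^sub>R \<epsilon> j + (x - y)"
  have "?\<gamma> \<in> long_affine" unfolding long_affine_def using a ij xy by fastforce
  moreover have "B (a *\<^sub>R \<epsilon> i + x) ?\<gamma> = c"
    using x shift_facts(2)[OF xy] orth ij a by (auto simp: B_simps)
  ultimately have "(a *\<^sub>R \<epsilon> i + x) - ?\<gamma> \<in> orbit (a *\<^sub>R \<epsilon> i + x)" by (rule orbit_long_step)
  then show ?thesis by (simp add: algebra_simps)
qed

lemma long_shifts_zero: "0 \<in> long_shifts"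
  unfolding long_shifts_def using int_module.span_zero[of S1] S2_closed(1)
  by (intro CollectI exI[of _ 0]) simp

text \<open>Two steps through a third index also cover the case \<open>i = j\<close>.\<close>

lemma short_orbit:
  assumes \<alpha>: "\<alpha> \<in> short_affine" and \<beta>: "\<beta> \<in> short_affine" and eq: "parity_class \<alpha> = parity_class \<beta>"
  shows "\<beta> \<in> orbit \<alpha>"
proof -
  obtain a i x y where \<alpha>': "a \<in> {1, -1}" "i \<in> {1..l}" "x \<in> S1" "y \<in> S2" "\<alpha> = a *\<^sub>R \<epsilon> i + (x + y)"
    using \<alpha> unfolding short_affine_def by blast
  obtain b j x' y' where \<beta>': "b \<in> {1, -1}" "j \<in> {1..l}" "x' \<in> S1" "y' \<in> S2" "\<beta> = b *\<^sub>R \<epsilon> j + (x' + y')"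
    using \<beta> unfolding short_affine_def by blast
  note x = S1_zspan[OF \<alpha>'(3)] and x' = S1_zspan[OF \<beta>'(3)]
  have er: "e r \<alpha> = e r x" "e r \<beta> = e r x'" if r: "r \<in> {1..n}" for r
    using \<alpha>' \<beta>' e_S2[OF r] e_W[OF r eps_W]
    by (simp_all add: blinfun.add_right blinfun.scaleR_right)
  have "even (\<lfloor>e r x\<rfloor> - \<lfloor>e r x'\<rfloor>)" if r: "r \<in> {1..n}" for r
  proof -
    have "r \<in> parity_class \<alpha> \<longleftrightarrow> r \<in> parity_class \<beta>" using eq by simp
    then show ?thesis using er[OF r] r by (simp add: parity_class_def)
  qed
  then obtain z where z: "z \<in> zspan S1" "x = x' + 2 *\<^sub>R z"
    using same_parity_imp_congruent[OF x x'] by blast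
  have "(x + y) - (x' + y') = 2 *\<^sub>R z + (y - y')" using z by simp
  then have shift: "(x + y) - (x' + y') \<in> long_shifts"
    unfolding long_shifts_def using z(1) S2_closed(3)[OF \<alpha>'(4) \<beta>'(4)] by blast
  have rad: "B (x + y) w = 0" "B w (x + y) = 0" for w
    using x \<alpha>'(4) rad1 rad2 rad_right by (simp_all add: B_simps)
  obtain k where k: "k \<in> {1..l}" "k \<noteq> i" "k \<noteq> j" by (rule third_index)
  have "1 *\<^sub>R \<epsilon> k + (x + y) \<in> orbit \<alpha>"
    unfolding \<alpha>'(5) using \<alpha>' k rad long_shifts_zero by (intro orbit_short_step) auto
  moreover have "\<beta> \<in> orbit (1 *\<^sub>R \<epsilon> k + (x + y))"
    unfolding \<beta>'(5) using \<beta>' k rad shift by (intro orbit_short_step) auto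
  ultimately show ?thesis by (rule orbit_trans)
qed

text \<open>One summand of a long root can be replaced by any other with an index different from \<open>i\<close>; a third
  index serves to change only the sign or the shift. For \<open>l = 2\<close> there is no such index.\<close>

lemma orbit_long_change:
  assumes a: "a \<in> {1, -1}" "b \<in> {1, -1}" "b' \<in> {1, -1}"
    and ij: "i \<in> {1..l}" "j \<in> {1..l}" "k \<in> {1..l}" "j \<noteq> i" "k \<noteq> i"
    and p: "p \<in> long_shifts" "q \<in> long_shifts"
  shows "a *\<^sub>R \<epsilon> i + b' *\<^sub>R \<epsilon> k + q \<in> orbit (a *\<^sub>R \<epsilon> i + b *\<^sub>R \<epsilon> j + p)"
proof -
  have step: "a *\<^sub>R \<epsilon> i + b' *\<^sub>R \<epsilon> k + q \<in> orbit (a *\<^sub>R \<epsilon> i + b *\<^sub>R \<epsilon> j + p)"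
    if "b \<in> {1, -1}" "b' \<in> {1, -1}" "j \<in> {1..l}" "k \<in> {1..l}" "j \<noteq> i" "k \<noteq> i" "j \<noteq> k"
      "p \<in> long_shifts" for b b' j k p
  proof -
    let ?\<gamma> = "b *\<^sub>R \<epsilon> j + (- b') *\<^sub>R \<epsilon> k + (p - q)"
    have pq: "p - q \<in> long_shifts" using that p(2) by (intro long_shifts_diff)
    have "?\<gamma> \<in> long_affine" unfolding long_affine_def using that pq by fastforce
    moreover have "B (a *\<^sub>R \<epsilon> i + b *\<^sub>R \<epsilon> j + p) ?\<gamma> = c"
      using that ij(1) orth shift_facts(1,2)[OF that(8)] shift_facts(1,2)[OF pq]
      by (auto simp: B_simps)
    ultimately have "(a *\<^sub>R \<epsilon> i + b *\<^sub>R \<epsilon> j + p) - ?\<gamma> \<in> orbit (a *\<^sub>R \<epsilon> i + b *\<^sub>R \<epsilon> j + p)"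
      by (rule orbit_long_step)
    moreover have "(a *\<^sub>R \<epsilon> i + b *\<^sub>R \<epsilon> j + p) - ?\<gamma> = a *\<^sub>R \<epsilon> i + b' *\<^sub>R \<epsilon> k + q" by simp
    ultimately show ?thesis by (simp only:)
  qed
  obtain m where m: "m \<in> {1..l}" "m \<noteq> i" "m \<noteq> j" by (rule third_index)
  show ?thesis
  proof (cases "j = k")
    case False
    then show ?thesis using a ij p by (intro step) auto
  next
    case True
    have "a *\<^sub>R \<epsilon> i + 1 *\<^sub>R \<epsilon> m + q \<in> orbit (a *\<^sub>R \<epsilon> i + b *\<^sub>R \<epsilon> j + p)"
      using a ij p m by (intro step) auto
    moreover have "a *\<^sub>R \<epsilon> i + b' *\<^sub>R \<epsilon> k + q \<in> orbit (a *\<^sub>R \<epsilon> i + 1 *\<^sub>R \<epsilon> m + q)"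
      using a ij p m True by (intro step) auto
    ultimately show ?thesis by (rule orbit_trans)
  qed
qed

text \<open>One of the two indices of \<open>\<beta>\<close> differs from \<open>i\<close>, so its summand can be exchanged first.\<close>

lemma long_orbit:
  assumes \<alpha>: "\<alpha> \<in> long_affine" and \<beta>: "\<beta> \<in> long_affine"
  shows "\<beta> \<in> orbit \<alpha>"
proof -
  obtain a b i j p where \<alpha>': "a \<in> {1, -1}" "b \<in> {1, -1}" "i \<in> {1..l}" "j \<in> {1..l}" "i \<noteq> j"
    "p \<in> long_shifts" "\<alpha> = a *\<^sub>R \<epsilon> i + b *\<^sub>R \<epsilon> j + p"
    using \<alpha> unfolding long_affine_def by blast
  have via: "a' *\<^sub>R \<epsilon> i' + b' *\<^sub>R \<epsilon> j' + q \<in> orbit \<alpha>"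
    if \<beta>': "a' \<in> {1, -1}" "b' \<in> {1, -1}" "i' \<in> {1..l}" "j' \<in> {1..l}" "i' \<noteq> j'"
      "q \<in> long_shifts" "j' \<noteq> i" for a' b' i' j' q
  proof -
    have "a *\<^sub>R \<epsilon> i + b' *\<^sub>R \<epsilon> j' + q \<in> orbit \<alpha>"
      unfolding \<alpha>'(7) using \<alpha>' \<beta>' by (intro orbit_long_change) auto
    moreover have "b' *\<^sub>R \<epsilon> j' + a' *\<^sub>R \<epsilon> i' + q \<in> orbit (b' *\<^sub>R \<epsilon> j' + a *\<^sub>R \<epsilon> i + q)"
      using \<alpha>' \<beta>' by (intro orbit_long_change) auto
    ultimately show ?thesis using orbit_trans by (simp add: add.commute)
  qed
  obtain a' b' i' j' q where \<beta>': "a' \<in> {1, -1}" "b' \<in> {1, -1}" "i' \<in> {1..l}" "j' \<in> {1..l}" "i' \<noteq> j'"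
    "q \<in> long_shifts" "\<beta> = a' *\<^sub>R \<epsilon> i' + b' *\<^sub>R \<epsilon> j' + q"
    using \<beta> unfolding long_affine_def by blast
  show ?thesis
  proof (cases "j' = i")
    case False
    then show ?thesis unfolding \<beta>'(7) using \<beta>' by (intro via) auto
  next
    case True
    then have "b' *\<^sub>R \<epsilon> j' + a' *\<^sub>R \<epsilon> i' + q \<in> orbit \<alpha>" using \<beta>' by (intro via) auto
    then show ?thesis unfolding \<beta>'(7) by (simp add: add.commute)
  qed
qed

section \<open>A redundant orbit forces a quadratic dependency\<close>

text \<open>Short reflections act on the \<open>\<epsilon> i\<close> modulo the radical by sign changes only.\<close>

lemma short_reflections_preserve_axis:
  assumes "w \<in> reflection_group A" and A: "A \<subseteq> short_affine"
  shows "\<forall>v. (\<forall>j\<in>{1..l} - {i}. B v (\<epsilon> j) = 0) \<longrightarrow>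
    (\<exists>v'. w (v, 0) = (v', 0) \<and> (\<forall>j\<in>{1..l} - {i}. B v' (\<epsilon> j) = 0))"
  using assms(1)
proof (induction rule: reflection_group_induct)
  case (nonisotropic \<alpha>)
  then show ?case using A roots_nonisotropic by (auto simp: roots_def)
next
  case one
  then show ?case by simp
next
  case (reflection \<alpha>)
  show ?case
  proof (intro allI impI)
    fix v assume v: "\<forall>j\<in>{1..l} - {i}. B v (\<epsilon> j) = 0"
    obtain a k where ak: "k \<in> {1..l}" "\<And>v. B v \<alpha> = a * B v (\<epsilon> k)"
      "\<And>j. j \<in> {1..l} \<Longrightarrow> B \<alpha> (\<epsilon> j) = (if k = j then a * c else 0)"
      using subsetD[OF A reflection] by (rule short_affineE) blast
    have "B (v - coeff \<alpha> 0 v *\<^sub>R \<alpha>) (\<epsilon> j) = 0" if j: "j \<in> {1..l} - {i}" for j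
    proof (cases "k = j")
      case True
      then have "B v \<alpha> = 0" using ak(2) v j by simp
      then have "coeff \<alpha> 0 v = 0" by (simp add: coeff_def blinfun.zero_left)
      then show ?thesis using v j by simp
    next
      case False
      then show ?thesis using v j ak(3)[of j] by (simp add: B_simps)
    qed
    then show "\<exists>v'. reflection B W \<alpha> (v, 0) = (v', 0) \<and> (\<forall>j\<in>{1..l} - {i}. B v' (\<epsilon> j) = 0)"
      by (simp add: reflection_apply)
  qed
next
  case (compose g h)
  show ?case
  proof (intro allI impI)
    fix v assume "\<forall>j\<in>{1..l} - {i}. B v (\<epsilon> j) = 0"
    then obtain v1 where v1: "h (v, 0) = (v1, 0)" "\<forall>j\<in>{1..l} - {i}. B v1 (\<epsilon> j) = 0"
      using compose by blast
    then obtain v2 where "g (v1, 0) = (v2, 0)" "\<forall>j\<in>{1..l} - {i}. B v2 (\<epsilon> j) = 0"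
      using compose by blast
    with v1 show "\<exists>v'. compose (hyp_space W) g h (v, 0) = (v', 0) \<and> (\<forall>j\<in>{1..l} - {i}. B v' (\<epsilon> j) = 0)"
      by (simp add: compose_def)
  qed
qed

lemma long_reflection_not_generated_by_short:
  assumes \<alpha>: "\<alpha> \<in> long_affine" and A: "A \<subseteq> short_affine"
  shows "reflection B W \<alpha> \<notin> reflection_group A"
proof
  assume "reflection B W \<alpha> \<in> reflection_group A"
  note inv = short_reflections_preserve_axis[OF this A]
  obtain a b i j where ab: "a = 1 \<or> a = -1" "b = 1 \<or> b = -1" "i \<in> {1..l}" "j \<in> {1..l}" "i \<noteq> j"
    "\<And>v. B v \<alpha> = a * B v (\<epsilon> i) + b * B v (\<epsilon> j)"
    "\<And>k. k \<in> {1..l} \<Longrightarrow> B \<alpha> (\<epsilon> k) = (if k = i then a * c else if k = j then b * c else 0)"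
    "B \<alpha> \<alpha> = 2 * c"
    using \<alpha> by (rule long_affineE) blast
  have B\<alpha>: "B (\<epsilon> i) \<alpha> = a * c" unfolding ab(6) using orth ab(3-5) by simp
  have coeff: "coeff \<alpha> 0 (\<epsilon> i) = a"
    unfolding coeff_def unfolding ab(8) B\<alpha> using c_pos by (simp add: blinfun.zero_left)
  have "\<forall>k\<in>{1..l} - {i}. B (\<epsilon> i) (\<epsilon> k) = 0" using orth ab(3) by auto
  then have "B (\<epsilon> i - a *\<^sub>R \<alpha>) (\<epsilon> j) = 0"
    using inv[of i] ab(4,5) by (auto simp: reflection_apply coeff)
  then show False unfolding B_simps ab(7)[OF ab(4)]
    using orth[OF ab(3,4)] ab(1,2,5) c_pos by auto
qed

text \<open>The reflection in \<open>\<alpha>\<close> is recorded by its own class alone. If its orbit is redundant, it is also recorded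
  by a set of classes of roots in other orbits, which cannot contain the class of \<open>\<alpha>\<close>.\<close>

theorem redundant_orbit_imp_dependency:
  assumes \<alpha>: "\<alpha> \<in> roots" and red: "reflection_group (roots - orbit \<alpha>) = reflection_group roots"
  obtains P where "P \<subseteq> supp S1 n \<sigma>" "P \<noteq> {}" "quadratic_dependency P"
proof -
  have mem: "reflection B W \<alpha> \<in> reflection_group (roots - orbit \<alpha>)"
    unfolding red using \<alpha> by (rule reflection_in_group)
  have "\<alpha> \<in> short_affine"
  proof (rule ccontr)
    assume "\<alpha> \<notin> short_affine"
    then have "\<alpha> \<in> long_affine" using \<alpha> by (simp add: roots_def)
    moreover from this have "roots - orbit \<alpha> \<subseteq> short_affine" using long_orbit by (auto simp: roots_def)
    ultimately show False using long_reflection_not_generated_by_short mem by blast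
  qed
  let ?p = "parity_class \<alpha>"
  have "roots - orbit \<alpha> \<subseteq> roots" by blast
  from reflection_group_tracks[OF mem this]
  obtain P where P: "P \<subseteq> parity_class ` ((roots - orbit \<alpha>) \<inter> short_affine)" "tracks (reflection B W \<alpha>) P"
    by blast
  have "?p \<notin> P" using P(1) short_orbit[OF \<open>\<alpha> \<in> short_affine\<close>] by fastforce
  have sub: "insert ?p P \<subseteq> supp S1 n \<sigma>"
    using P(1) \<open>\<alpha> \<in> short_affine\<close> parity_class_in_supp by blast
  have "quadratic_dependency (insert ?p P)"
  proof (rule tracks_twice_imp_dependency[OF tracks_short[OF \<open>\<alpha> \<in> short_affine\<close>] P(2) \<open>?p \<notin> P\<close>])
    fix q assume "q \<in> insert ?p P"
    then show "q \<subseteq> {1..n}" using sub by (auto simp: supp_def)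
  qed
  with sub show thesis using that by blast
qed

section \<open>Full support in dimension 3 makes an orbit redundant\<close>

text \<open>An upper bound for the orbit of \<open>\<epsilon> 1\<close>: one nonzero finite coordinate and even isotropic
  coordinates.\<close>

definition even_axis_states :: "'v set" where
  "even_axis_states = {v. (\<exists>i\<in>{1..l}. \<exists>a\<in>{1,-1}. \<forall>j\<in>{1..l}. B v (\<epsilon> j) = (if j = i then a * c else 0)) \<and>
     (\<forall>r\<in>{1..n}. \<exists>m::int. e r v = of_int (2 * m))}"

lemma even_axis_step:
  assumes \<alpha>: "\<alpha> \<in> roots" and v: "v \<in> even_axis_states"
  shows "v - coeff \<alpha> 0 v *\<^sub>R \<alpha> \<in> even_axis_states"
proof -
  obtain i a where ia: "i \<in> {1..l}" "a = 1 \<or> a = -1"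
    and Bv: "\<And>j. j \<in> {1..l} \<Longrightarrow> B v (\<epsilon> j) = (if j = i then a * c else 0)"
    and ev: "\<And>r. r \<in> {1..n} \<Longrightarrow> \<exists>m::int. e r v = of_int (2 * m)"
    using v unfolding even_axis_states_def by blast
  obtain a' :: int where a': "a = of_int a'" using ia(2) by (metis of_int_1 of_int_minus)
  have ev': "\<exists>m::int. e r (v - (of_int k) *\<^sub>R \<alpha>) = of_int (2 * m)"
    if r: "r \<in> {1..n}" and d: "e r \<alpha> = of_int d" and kd: "even (k * d)" for r k d
  proof -
    obtain m where "e r v = of_int (2 * m)" using ev r by blast
    moreover obtain m' where "k * d = 2 * m'" using kd by blast
    moreover from this have "real_of_int k * of_int d = 2 * of_int m'"
      by (metis of_int_mult of_int_numeral)
    ultimately have "e r (v - (of_int k) *\<^sub>R \<alpha>) = of_int (2 * (m - m'))"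
      using d by (simp add: blinfun.diff_right blinfun.scaleR_right)
    then show ?thesis by blast
  qed
  show ?thesis
  proof (cases "\<alpha> \<in> short_affine")
    case True
    then obtain b j d where bj: "b = 1 \<or> b = -1" "j \<in> {1..l}" "\<And>v. B v \<alpha> = b * B v (\<epsilon> j)"
      "\<And>k. k \<in> {1..l} \<Longrightarrow> B \<alpha> (\<epsilon> k) = (if j = k then b * c else 0)" "B \<alpha> \<alpha> = c"
      and d: "\<And>r. r \<in> {1..n} \<Longrightarrow> e r \<alpha> = of_int (d r)"
      by (rule short_affineE) blast
    obtain b' :: int where b': "b = of_int b'" using bj(1) by (metis of_int_1 of_int_minus)
    define k where "k = (if j = i then 2 * a' * b' else 0)"
    have k: "coeff \<alpha> 0 v = of_int k"
      unfolding coeff_def unfolding bj(5) unfolding bj(3) Bv[OF bj(2)] k_def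
      using c_pos by (simp add: blinfun.zero_left a' b')
    have "\<forall>m\<in>{1..l}. B (v - coeff \<alpha> 0 v *\<^sub>R \<alpha>) (\<epsilon> m) = (if m = i then (if j = i then - a else a) * c else 0)"
      unfolding k k_def using Bv bj(4) bj(1) by (auto simp: B_simps a' b')
    moreover have "(if j = i then - a else a) \<in> {1, -1}" using ia(2) by auto
    moreover have "\<forall>r\<in>{1..n}. \<exists>m::int. e r (v - coeff \<alpha> 0 v *\<^sub>R \<alpha>) = of_int (2 * m)"
      unfolding k using ev' d by (auto simp: k_def)
    ultimately show ?thesis unfolding even_axis_states_def using ia(1) by blast
  next
    case False
    then have "\<alpha> \<in> long_affine" using \<alpha> by (simp add: roots_def)
    then obtain b b2 j j2 d where bj: "b = 1 \<or> b = -1" "b2 = 1 \<or> b2 = -1" "j \<in> {1..l}" "j2 \<in> {1..l}" "j \<noteq> j2"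
      "\<And>v. B v \<alpha> = b * B v (\<epsilon> j) + b2 * B v (\<epsilon> j2)"
      "\<And>k. k \<in> {1..l} \<Longrightarrow> B \<alpha> (\<epsilon> k) = (if k = j then b * c else if k = j2 then b2 * c else 0)"
      "B \<alpha> \<alpha> = 2 * c" and d: "\<And>r. r \<in> {1..n} \<Longrightarrow> e r \<alpha> = of_int (2 * d r)"
      by (rule long_affineE) blast
    obtain b' b2' :: int where b': "b = of_int b'" "b2 = of_int b2'"
      using bj(1,2) by (metis of_int_1 of_int_minus)
    define k where "k = (if j = i then a' * b' else if j2 = i then a' * b2' else 0)"
    have k: "coeff \<alpha> 0 v = of_int k"
      unfolding coeff_def unfolding bj(8) unfolding bj(6) Bv[OF bj(3)] Bv[OF bj(4)] k_def
      using c_pos bj(5) by (auto simp: blinfun.zero_left a' b')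
    define i' where "i' = (if j = i then j2 else if j2 = i then j else i)"
    define a2 where "a2 = (if j = i \<or> j2 = i then - (a * b * b2) else a)"
    have "\<forall>m\<in>{1..l}. B (v - coeff \<alpha> 0 v *\<^sub>R \<alpha>) (\<epsilon> m) = (if m = i' then a2 * c else 0)"
      unfolding k k_def i'_def a2_def using Bv bj(1,2,5,7) by (auto simp: B_simps a' simp flip: b')
    moreover have "a2 \<in> {1, -1}" "i' \<in> {1..l}" using ia bj(1-4) by (auto simp: a2_def i'_def)
    moreover have "\<forall>r\<in>{1..n}. \<exists>m::int. e r (v - coeff \<alpha> 0 v *\<^sub>R \<alpha>) = of_int (2 * m)"
      unfolding k using ev' d by (meson dvd_triv_left dvd_mult)
    ultimately show ?thesis unfolding even_axis_states_def by blast
  qed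
qed

lemma reflection_group_even_axis:
  assumes "w \<in> reflection_group roots"
  shows "\<forall>v\<in>even_axis_states. \<exists>v'\<in>even_axis_states. w (v, 0) = (v', 0)"
  using assms
proof (induction rule: reflection_group_induct)
  case (compose g h)
  show ?case
  proof
    fix v assume "v \<in> even_axis_states"
    then obtain v1 where v1: "v1 \<in> even_axis_states" "h (v, 0) = (v1, 0)" using compose by blast
    then obtain v2 where v2: "v2 \<in> even_axis_states" "g (v1, 0) = (v2, 0)" using compose by blast
    have "compose (hyp_space W) g h (v, 0) = (v2, 0)" using v1 v2 by (simp add: compose_def)
    with v2 show "\<exists>v'\<in>even_axis_states. compose (hyp_space W) g h (v, 0) = (v', 0)" by blast
  qed
qed (use roots_nonisotropic even_axis_step in \<open>auto simp: reflection_apply\<close>)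

text \<open>Full support means that \<open>S1\<close> is a lattice. Then for \<open>\<beta>\<close> in the orbit of \<open>\<epsilon> 1\<close> and nonempty \<open>J\<close> the
  vectors \<open>\<beta> + sum \<sigma> J\<close> are roots, and they lie outside this orbit because some of their
  coordinates are odd. So seven of the eight reflections in \<open>eight_reflections\<close> remain available.\<close>

theorem full_support_imp_redundant_orbit:
  assumes n: "n = 3" and full: "supp S1 n \<sigma> = Pow {1..n}"
  obtains \<alpha> where "\<alpha> \<in> roots" "reflection_group (roots - orbit \<alpha>) = reflection_group roots"
proof -
  have S1: "x \<in> S1" if x: "x \<in> zspan S1" for x
  proof -
    let ?J = "{r \<in> {1..n}. odd \<lfloor>e r x\<rfloor>}"
    have J: "?J \<subseteq> {1..n}" by auto
    then have "?J \<in> supp S1 n \<sigma>" unfolding full by blast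
    then have JS: "sum \<sigma> ?J \<in> S1" by (simp add: supp_def)
    have "even (\<lfloor>e r x\<rfloor> - \<lfloor>e r (sum \<sigma> ?J)\<rfloor>)" if r: "r \<in> {1..n}" for r
      unfolding e_sum_\<sigma>[OF r J] using r by auto
    then obtain z where "z \<in> zspan S1" "x = sum \<sigma> ?J + 2 *\<^sub>R z"
      using same_parity_imp_congruent[OF x S1_zspan[OF JS]] by blast
    then show ?thesis using S1_double[OF JS, of z] by (simp only:)
  qed
  define \<alpha> where "\<alpha> = \<epsilon> 1"
  have one: "1 \<in> {1..l}" using l3 by simp
  have "\<alpha> = 1 *\<^sub>R \<epsilon> 1 + (0 + 0)" by (simp add: \<alpha>_def)
  then have "\<alpha> \<in> short_affine"
    unfolding short_affine_def using one S1_zero S2_closed(1) by blast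
  then have \<alpha>: "\<alpha> \<in> roots" by (simp add: roots_def)
  have \<alpha>_state: "\<alpha> \<in> even_axis_states"
    unfolding even_axis_states_def \<alpha>_def using one orth e_W[OF _ eps_W[OF one]]
    by (auto intro!: bexI[of _ 1] exI[of _ 0])
  have orbit: "\<beta> \<in> even_axis_states" if "\<beta> \<in> orbit \<alpha>" for \<beta>
    using that reflection_group_even_axis \<alpha>_state unfolding orbit_def by fastforce
  have orbit_even: "\<exists>m::int. e r \<beta> = of_int (2 * m)" if "\<beta> \<in> orbit \<alpha>" "r \<in> {1..n}" for \<beta> r
    using orbit[OF that(1)] that(2) unfolding even_axis_states_def by blast
  have "reflection B W \<beta> \<in> reflection_group (roots - orbit \<alpha>)" if \<beta>: "\<beta> \<in> roots" for \<beta>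
  proof (cases "\<beta> \<in> orbit \<alpha>")
    case False
    then show ?thesis using \<beta> by (intro reflection_in_group) simp
  next
    case True
    have "\<beta> \<notin> long_affine"
    proof
      assume "\<beta> \<in> long_affine"
      then obtain a b i j where ab: "a = 1 \<or> a = -1" "b = 1 \<or> b = -1" "i \<in> {1..l}" "j \<in> {1..l}" "i \<noteq> j"
        "\<And>k. k \<in> {1..l} \<Longrightarrow> B \<beta> (\<epsilon> k) = (if k = i then a * c else if k = j then b * c else 0)"
        by (rule long_affineE) blast
      obtain m a' where m: "\<forall>j\<in>{1..l}. B \<beta> (\<epsilon> j) = (if j = m then a' * c else 0)"
        using orbit[OF True] unfolding even_axis_states_def by blast
      have "B \<beta> (\<epsilon> i) \<noteq> 0" "B \<beta> (\<epsilon> j) \<noteq> 0" using ab c_pos by auto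
      then show False using m ab(3-5) by (metis (full_types))
    qed
    then have "\<beta> \<in> short_affine" using \<beta> by (simp add: roots_def)
    then obtain a i x y where \<beta>': "a \<in> {1, -1}" "i \<in> {1..l}" "x \<in> S1" "y \<in> S2" "\<beta> = a *\<^sub>R \<epsilon> i + (x + y)"
      unfolding short_affine_def by blast
    let ?A = "roots - orbit \<alpha>"
    have sumz: "sum \<sigma> J \<in> zspan S1" if "J \<subseteq> {1..n}" for J
      unfolding \<sigma>_span[symmetric] using that by (intro int_module.span_sum int_module.span_base) auto
    have rest: "\<beta> + sum \<sigma> J \<in> ?A" if J: "J \<subseteq> {1..n}" "J \<noteq> {}" for J
    proof -
      have "x + sum \<sigma> J \<in> S1" using S1 int_module.span_add[OF S1_zspan[OF \<beta>'(3)] sumz[OF J(1)]] by blast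
      moreover have "\<beta> + sum \<sigma> J = a *\<^sub>R \<epsilon> i + ((x + sum \<sigma> J) + y)" by (simp add: \<beta>'(5))
      ultimately have "\<beta> + sum \<sigma> J \<in> roots"
        unfolding roots_def short_affine_def using \<beta>'(1,2,4) by blast
      moreover have "\<beta> + sum \<sigma> J \<notin> orbit \<alpha>"
      proof
        assume mem: "\<beta> + sum \<sigma> J \<in> orbit \<alpha>"
        obtain r where r: "r \<in> J" using J(2) by blast
        then have r': "r \<in> {1..n}" using J(1) by blast
        obtain m m' :: int where "e r (\<beta> + sum \<sigma> J) = of_int (2 * m)" "e r \<beta> = of_int (2 * m')"
          using orbit_even[OF mem r'] orbit_even[OF True r'] by blast
        then have "real_of_int (2 * m) = of_int (2 * m' + 1)"
          using e_sum_\<sigma>[OF r' J(1)] r by (simp add: blinfun.add_right)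
        then have "2 * m = 2 * m' + 1" by (simp only: of_int_eq_iff)
        then show False by presburger
      qed
      ultimately show ?thesis by blast
    qed
    define g where "g J = reflection B W (\<beta> + sum \<sigma> J)" for J
    have g_mem: "g J \<in> reflection_group ?A" if "J \<subseteq> {1..n}" "J \<noteq> {}" for J
      unfolding g_def by (rule reflection_in_group[OF rest[OF that]])
    let ?H = "hyp_space W"
    \<comment> \<open>The word of \<open>eight_reflections\<close>, with \<open>\<sigma> 3\<close>, \<open>\<sigma> 1\<close>, \<open>\<sigma> 2\<close> in the roles of \<open>\<rho>\<close>, \<open>\<sigma>\<close>, \<open>\<tau>\<close>.\<close>
    let ?w = "compose ?H (g {1}) (compose ?H (g {3,1}) (compose ?H (g {3}) (compose ?H (g {3,2})
      (compose ?H (g {3,1,2}) (compose ?H (g {1,2}) (g {2}))))))"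
    have "?w \<in> reflection_group ?A"
      by (intro reflection_group_compose g_mem) (use n roots_nonisotropic in auto)
    moreover have "reflection B W \<beta> = ?w"
    proof (rule extensionalityI[of _ ?H])
      show "reflection B W \<beta> \<in> extensional ?H" by (simp add: reflection_def)
      show "?w \<in> extensional ?H" by (simp add: compose_def)
      fix u assume u: "u \<in> ?H"
      have maps: "g J u' \<in> ?H" if "u' \<in> ?H" for J u'
        unfolding g_def using that by (rule reflection_maps)
      have rad: "B z w = 0" if "z \<in> {\<sigma> 3, \<sigma> 1, \<sigma> 2}" for z w
      proof -
        have "z \<in> \<sigma> ` {1..n}" using that n by auto
        then have "z \<in> zspan S1" unfolding \<sigma>_span[symmetric] by (rule int_module.span_base)
        then show ?thesis by (rule rad1)
      qed
      have "reflection B W (\<beta> + 0) u = g {1} (g {3,1} (g {3} (g {3,2} (g {3,1,2} (g {1,2} (g {2} u))))))"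
        using eight_reflections[of \<beta> "\<sigma> 3" "\<sigma> 1" "\<sigma> 2" u, OF roots_nonisotropic[OF \<beta>] rad u]
        by (simp add: g_def add.assoc)
      then show "reflection B W \<beta> u = ?w u" using u maps by (simp add: compose_def)
    qed
    ultimately show ?thesis by simp
  qed
  then have "reflection_group roots \<subseteq> reflection_group (roots - orbit \<alpha>)"
    using roots_nonisotropic by (intro reflection_group_subset) auto
  moreover have "reflection_group (roots - orbit \<alpha>) \<subseteq> reflection_group roots"
    using roots_nonisotropic reflection_in_group by (intro reflection_group_subset) auto
  ultimately show thesis using that \<alpha> by blast
qed

section \<open>Extended affine root systems of type B\<close>

text \<open>The short roots have norm \<open>c\<close>, the long ones have norm \<open>2 * c\<close>, and \<open>S + S\<close> is isotropic.\<close>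

lemma nonisotropic_ears_B:
  assumes \<Phi>: "\<Phi> = {0} \<union> {s *\<^sub>R \<epsilon> i |s i. s \<in> {1, -1} \<and> i \<in> {1..l}}
    \<union> {s *\<^sub>R \<epsilon> i + s' *\<^sub>R \<epsilon> j |s s' i j. s \<in> {1, -1} \<and> s' \<in> {1, -1} \<and> i \<in> {1..l} \<and> j \<in> {1..l} \<and> i \<noteq> j}"
  shows "nonisotropic B (ears_B B \<Phi> S1 S2) = roots"
proof -
  define Sh where "Sh = {s *\<^sub>R \<epsilon> i |s i. s \<in> {1, -1} \<and> i \<in> {1..l}}"
  define Lg where "Lg = {s *\<^sub>R \<epsilon> i + s' *\<^sub>R \<epsilon> j |s s' i j. s \<in> {1, -1} \<and> s' \<in> {1, -1} \<and> i \<in> {1..l} \<and> j \<in> {1..l} \<and> i \<noteq> j}"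
  have \<Phi>': "\<Phi> = {0} \<union> Sh \<union> Lg" unfolding \<Phi> Sh_def Lg_def ..
  have Sh: "B \<alpha> \<alpha> = c" if "\<alpha> \<in> Sh" for \<alpha>
    using that orth unfolding Sh_def by (auto simp: B_simps)
  have Lg: "B \<alpha> \<alpha> = 2 * c" if "\<alpha> \<in> Lg" for \<alpha>
    using that orth unfolding Lg_def by (auto simp: B_simps)
  have nz: "0 \<notin> Sh" "0 \<notin> Lg" using Sh[of 0] Lg[of 0] c_pos by (auto simp: B_simps)
  have "1 *\<^sub>R \<epsilon> 1 \<in> Sh" unfolding Sh_def using l3 by fastforce
  then have \<epsilon>: "1 *\<^sub>R \<epsilon> 1 \<in> \<Phi> - {0}" "B (1 *\<^sub>R \<epsilon> 1) (1 *\<^sub>R \<epsilon> 1) = c"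
    using nz Sh unfolding \<Phi>' by (auto simp del: scaleR_one)
  have c_le: "c \<le> B \<beta> \<beta>" if "\<beta> \<in> \<Phi> - {0}" for \<beta>
    using that Sh[of \<beta>] Lg[of \<beta>] c_pos unfolding \<Phi>' by auto
  have norm: "B \<alpha> \<alpha> \<le> c \<longleftrightarrow> \<alpha> \<in> Sh" if "\<alpha> \<in> \<Phi> - {0}" for \<alpha>
    using that Sh[of \<alpha>] Lg[of \<alpha>] c_pos unfolding \<Phi>' by auto
  have "\<alpha> \<in> short_roots B \<Phi> \<longleftrightarrow> \<alpha> \<in> \<Phi> - {0} \<and> B \<alpha> \<alpha> \<le> c" for \<alpha>
  proof
    assume "\<alpha> \<in> short_roots B \<Phi>"
    then have "\<alpha> \<in> \<Phi> - {0}" and le: "\<forall>\<beta>\<in>\<Phi> - {0}. B \<alpha> \<alpha> \<le> B \<beta> \<beta>"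
      by (auto simp: short_roots_def)
    then show "\<alpha> \<in> \<Phi> - {0} \<and> B \<alpha> \<alpha> \<le> c"
      using bspec[OF le \<epsilon>(1)] unfolding \<epsilon>(2) by blast
  next
    assume \<alpha>: "\<alpha> \<in> \<Phi> - {0} \<and> B \<alpha> \<alpha> \<le> c"
    then have "\<forall>\<beta>\<in>\<Phi> - {0}. B \<alpha> \<alpha> \<le> B \<beta> \<beta>" by (meson c_le order_trans)
    with \<alpha> show "\<alpha> \<in> short_roots B \<Phi>" unfolding short_roots_def by blast
  qed
  then have short: "short_roots B \<Phi> = Sh"
    using norm nz unfolding \<Phi>' by blast
  have "Lg \<inter> Sh = {}" using Sh Lg c_pos by force
  then have long: "long_roots B \<Phi> = Lg"
    unfolding long_roots_def short unfolding \<Phi>' using nz by blast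
  have sh: "Sh + (S1 + S2) = short_affine"
  proof (intro subset_antisym subsetI)
    fix v assume "v \<in> Sh + (S1 + S2)"
    then obtain p x y where "p \<in> Sh" "x \<in> S1" "y \<in> S2" "v = p + (x + y)"
      by (elim set_plus_elim) blast
    then show "v \<in> short_affine" unfolding Sh_def short_affine_def by blast
  next
    fix v assume "v \<in> short_affine"
    then obtain a i x y where "a \<in> {1, -1}" "i \<in> {1..l}" "x \<in> S1" "y \<in> S2"
      and v: "v = a *\<^sub>R \<epsilon> i + (x + y)"
      unfolding short_affine_def by blast
    then show "v \<in> Sh + (S1 + S2)"
      unfolding v Sh_def by (intro set_plus_intro) blast+
  qed
  have shifts: "(\<lambda>x. 2 *\<^sub>R x) ` zspan S1 + S2 = long_shifts"
    unfolding long_shifts_def set_plus_def by blast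
  have lg: "Lg + ((\<lambda>x. 2 *\<^sub>R x) ` zspan S1 + S2) = long_affine"
    unfolding shifts
  proof (intro subset_antisym subsetI)
    fix v assume "v \<in> Lg + long_shifts"
    then obtain q p where "q \<in> Lg" "p \<in> long_shifts" "v = q + p"
      by (elim set_plus_elim) blast
    then show "v \<in> long_affine" unfolding Lg_def long_affine_def by blast
  next
    fix v assume "v \<in> long_affine"
    then obtain a i b j p where "a \<in> {1, -1}" "b \<in> {1, -1}" "i \<in> {1..l}" "j \<in> {1..l}" "i \<noteq> j" "p \<in> long_shifts"
      and v: "v = a *\<^sub>R \<epsilon> i + b *\<^sub>R \<epsilon> j + p"
      unfolding long_affine_def by blast
    then show "v \<in> Lg + long_shifts"
      unfolding v Lg_def by (intro set_plus_intro) blast+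
  qed
  have S_rad: "B p z = 0" if "p \<in> S1 + S2" for p z
    using that by (rule set_plus_elim) (simp add: B_simps rad1 S1_zspan rad2)
  have rad: "B v v = 0" if "v \<in> (S1 + S2) + (S1 + S2)" for v
    using that by (rule set_plus_elim) (simp add: B_simps S_rad)
  have "ears_B B \<Phi> S1 S2 = ((S1 + S2) + (S1 + S2)) \<union> short_affine \<union> long_affine"
    unfolding ears_B_def Let_def S2_zspan short long sh lg ..
  then show ?thesis
    unfolding nonisotropic_def using rad roots_nonisotropic unfolding roots_def by blast
qed

lemma minimal_ears_iff:
  assumes "nonisotropic B R = roots"
  shows "minimal_ears B W R \<longleftrightarrow>
    \<not> (\<exists>\<alpha>\<in>roots. reflection_group (roots - orbit \<alpha>) = reflection_group roots)"
proof -
  have weyl: "weyl_group B W R = reflection_group roots"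
    unfolding weyl_group_def reflection_group_def assms ..
  have "weyl_orbit B W R \<alpha> = orbit \<alpha>" for \<alpha>
    unfolding weyl_orbit_def orbit_def weyl ..
  then show ?thesis
    unfolding minimal_ears_def weyl assms reflection_group_def by (simp only:)
qed

end

text \<open>The empty set and the \<open>n\<close> singletons account for \<open>n + 1\<close> points of the support.\<close>

lemma card_supp:
  assumes "zbasis_from S n \<sigma>" and "0 \<in> S"
  shows "supp S n \<sigma> \<subseteq> Pow {1..n}" and "finite (supp S n \<sigma>)"
    and "n + 1 + card {q \<in> supp S n \<sigma>. 2 \<le> card q} \<le> card (supp S n \<sigma>)"
proof -
  show sub: "supp S n \<sigma> \<subseteq> Pow {1..n}" by (auto simp: supp_def)
  then show fin: "finite (supp S n \<sigma>)" by (rule finite_subset) simp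
  let ?H = "{q \<in> supp S n \<sigma>. 2 \<le> card q}" and ?L = "insert {} ((\<lambda>r. {r}) ` {1..n})"
  have L: "?L \<subseteq> supp S n \<sigma>"
    using assms by (auto simp: supp_def zbasis_from_def)
  have "?L \<inter> ?H = {}" by auto
  moreover have "card ?L = n + 1"
    by (subst card_insert_disjoint) (auto simp: card_image)
  moreover have "finite ?L" "finite ?H" using fin by auto
  ultimately have "card (?L \<union> ?H) = n + 1 + card ?H" by (simp only: card_Un_disjoint)
  moreover have "card (?L \<union> ?H) \<le> card (supp S n \<sigma>)"
    using L by (intro card_mono[OF fin]) blast
  ultimately show "n + 1 + card ?H \<le> card (supp S n \<sigma>)" by simp
qed

theorem corollary37:
  fixes B :: "'v::euclidean_space \<Rightarrow> 'v \<Rightarrow> real"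
    and Vdot V1 V2 Rdot S1 S2 R :: "'v set"
    and l \<nu> t :: nat
  assumes "l \<ge> 3"
    and "bilinear B" and "\<And>x y. B x y = B y x" and "\<And>x. B x x \<ge> 0"
    and "subspace Vdot" and "subspace V1" and "subspace V2"
    and "form_radical B = V1 + V2" and "V1 \<inter> V2 = {0}"
    and "Vdot + form_radical B = UNIV" and "Vdot \<inter> form_radical B = {0}"
    and "t \<le> \<nu>" and "dim V1 = t" and "dim V2 = \<nu> - t"
    and "type_B B l Vdot Rdot"
    and "semilattice_in V1 S1" and "lattice_in V2 S2"
    and "R = ears_B B Rdot S1 S2"
  shows "(int (ind S1) - int t \<le> 3 \<or> (t \<le> 3 \<and> ind S1 \<noteq> 7) \<longrightarrow> minimal_ears B Vdot R) \<and>
         (t \<le> 3 \<longrightarrow> (minimal_ears B Vdot R \<longleftrightarrow> ind S1 \<noteq> 7))"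
proof -
  note S1 = \<open>semilattice_in V1 S1\<close>
  have S1': "S1 \<subseteq> V1" "0 \<in> S1" using S1 by (auto simp: semilattice_in_def)
  have S2: "S2 \<subseteq> V2" "zspan S2 = S2"
    using \<open>lattice_in V2 S2\<close> by (auto simp: lattice_in_def semilattice_in_def)
  obtain n \<sigma> where \<sigma>: "zbasis_from S1 n \<sigma>" and ind: "ind S1 = card (supp S1 n \<sigma>) - 1"
    using zbasis_from_ind[OF S1] .
  have n: "n = t" and indep: "independent (\<sigma> ` {1..n})"
    using zbasis_from_independent[OF S1 \<sigma>] \<open>dim V1 = t\<close> by auto
  have \<sigma>S: "\<sigma> ` {1..n} \<subseteq> S1" and inj: "inj_on \<sigma> {1..n}" and \<sigma>_span: "zspan (\<sigma> ` {1..n}) = zspan S1"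
    using \<sigma> by (auto simp: zbasis_from_def)
  obtain \<epsilon> c where c: "c > 0"
    and orth: "\<forall>i\<in>{1..l}. \<forall>j\<in>{1..l}. B (\<epsilon> i) (\<epsilon> j) = (if i = j then c else 0)"
    and span: "span (\<epsilon> ` {1..l}) = Vdot"
    and Rdot: "Rdot = {0} \<union> {s *\<^sub>R \<epsilon> i |s i. s \<in> {1, -1} \<and> i \<in> {1..l}}
              \<union> {s *\<^sub>R \<epsilon> i + s' *\<^sub>R \<epsilon> j |s s' i j.
                   s \<in> {1, -1} \<and> s' \<in> {1, -1} \<and> i \<in> {1..l} \<and> j \<in> {1..l} \<and> i \<noteq> j}"
    using \<open>type_B B l Vdot Rdot\<close> unfolding type_B_def by blast
  have V_rad: "V1 \<subseteq> form_radical B" "V2 \<subseteq> form_radical B"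
    unfolding \<open>form_radical B = V1 + V2\<close>
    using set_plus_intro[OF _ subspace_0[OF \<open>subspace V2\<close>], of _ V1]
      set_plus_intro[OF subspace_0[OF \<open>subspace V1\<close>], of _ V2] by auto
  \<comment> \<open>The sum of \<open>Vdot\<close>, \<open>V1\<close> and \<open>V2\<close> is direct, so the coordinates at the \<open>\<sigma> r\<close> extend to functionals
    that vanish on \<open>Vdot\<close> and \<open>V2\<close>.\<close>
  have outside: "b \<notin> span ((Vdot \<union> V2) \<union> (\<sigma> ` {1..n} - {b}))" if b: "b \<in> \<sigma> ` {1..n}" for b
  proof
    assume "b \<in> span ((Vdot \<union> V2) \<union> (\<sigma> ` {1..n} - {b}))"
    then obtain u z where u: "u \<in> span (Vdot \<union> V2)" and z: "z \<in> span (\<sigma> ` {1..n} - {b})" "b = u + z"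
      unfolding span_Un[of "Vdot \<union> V2"] by blast
    obtain w y where wy: "w \<in> span Vdot" "y \<in> span V2" "u = w + y"
      using u unfolding span_Un by blast
    have "span Vdot = Vdot" "span V2 = V2" using assms(5,7) by (simp_all only: span_eq_iff)
    then have wyz: "w \<in> Vdot" "y \<in> V2" "z \<in> span (\<sigma> ` {1..n} - {b})" "b = w + y + z"
      using wy(1,2) z(1) by (blast, blast, blast, simp only: z(2) wy(3))
    have "span (\<sigma> ` {1..n} - {b}) \<subseteq> V1"
      using \<sigma>S S1'(1) \<open>subspace V1\<close> by (intro span_minimal) auto
    then have bz: "b - z \<in> V1"
      using wyz(3) b \<sigma>S S1'(1) by (intro subspace_diff[OF \<open>subspace V1\<close>]) blast+
    have "w = (b - z) + (- y)" using wyz(4) by simp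
    then have "w \<in> form_radical B"
      unfolding \<open>form_radical B = V1 + V2\<close> using bz subspace_neg[OF \<open>subspace V2\<close> wyz(2)] by blast
    then have "w = 0" using wyz(1) \<open>Vdot \<inter> form_radical B = {0}\<close> by blast
    then have "b - z = y" using wyz(4) by (simp add: diff_eq_eq)
    then have "y = 0" using bz wyz(2) \<open>V1 \<inter> V2 = {0}\<close> by blast
    then have "b = z" using \<open>b - z = y\<close> by simp
    then show False using wyz(3) b indep unfolding dependent_def by blast
  qed
  obtain e :: "'v \<Rightarrow> 'v \<Rightarrow>\<^sub>L real"
    where e_zero: "\<And>b x. b \<in> \<sigma> ` {1..n} \<Longrightarrow> x \<in> span (Vdot \<union> V2) \<Longrightarrow> e b x = 0"
      and e_dual: "\<And>b b'. b \<in> \<sigma> ` {1..n} \<Longrightarrow> b' \<in> \<sigma> ` {1..n} \<Longrightarrow> e b b' = (if b = b' then 1 else 0)"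
    by (rule dual_basis_modulo[of "\<sigma> ` {1..n}" "Vdot \<union> V2"]) (erule outside, rule that)
  have rad: "B x z = 0" if "x \<in> V1 \<or> x \<in> V2" for x z
    using that V_rad unfolding form_radical_def by blast
  have zspan_V1: "zspan S1 \<subseteq> V1"
    using zspan_subset_span[of S1] S1 by (simp add: semilattice_in_def)
  interpret type_B_frame B Vdot l \<epsilon> c S1 S2 n \<sigma> "\<lambda>r. e (\<sigma> r)"
  proof unfold_locales
    show "bilinear B" "B x y = B y x" "3 \<le> l" "c > 0" for x y using assms(1-3) c by blast+
    show "B (\<epsilon> i) (\<epsilon> j) = (if i = j then c else 0)" if "i \<in> {1..l}" "j \<in> {1..l}" for i j
      using orth that by blast
    show "\<epsilon> i \<in> Vdot" if "i \<in> {1..l}" for i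
      unfolding span[symmetric] using that by (intro span_base imageI)
    show "B x z = 0" if "x \<in> zspan S1" for x z using rad that zspan_V1 by blast
    show "B y z = 0" if "y \<in> S2" for y z using rad that S2(1) by blast
    show "0 \<in> S1" "zspan S2 = S2" "zspan (\<sigma> ` {1..n}) = zspan S1" by fact+
    show "x + 2 *\<^sub>R y \<in> S1" if "x \<in> S1" "y \<in> zspan S1" for x y
      using semilattice_add_double[OF S1 that] .
    show "e (\<sigma> r) x = 0" if "r \<in> {1..n}" "x \<in> Vdot" for r x
      using that by (intro e_zero imageI span_base UnI1)
    show "e (\<sigma> r) x = 0" if "r \<in> {1..n}" "x \<in> S2" for r x
      using that S2(1) by (intro e_zero imageI span_base UnI2) auto
    show "e (\<sigma> r) (\<sigma> s) = (if r = s then 1 else 0)" if "r \<in> {1..n}" "s \<in> {1..n}" for r s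
      unfolding e_dual[OF imageI[OF that(1)] imageI[OF that(2)]] inj_on_eq_iff[OF inj that] ..
  qed
  have minimal: "minimal_ears B Vdot R \<longleftrightarrow>
      \<not> (\<exists>\<alpha>\<in>roots. reflection_group (roots - orbit \<alpha>) = reflection_group roots)"
    by (rule minimal_ears_iff) (simp only: \<open>R = _\<close> nonisotropic_ears_B[OF Rdot])
  note supp = card_supp[OF \<sigma> S1'(2)]
  have card: "card (supp S1 n \<sigma>) = ind S1 + 1" using ind supp(3) by linarith
  have le: "card (supp S1 n \<sigma>) \<le> 2 ^ n"
    using card_mono[OF _ supp(1)] by (simp add: card_Pow)
  have nonminimal: "int (ind S1) - int t > 3 \<and> (t \<le> 3 \<longrightarrow> ind S1 = 7)"
    if not_minimal: "\<not> minimal_ears B Vdot R"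
  proof -
    obtain \<alpha> where "\<alpha> \<in> roots" "reflection_group (roots - orbit \<alpha>) = reflection_group roots"
      using not_minimal unfolding minimal by blast
    then obtain P where P: "P \<subseteq> supp S1 n \<sigma>" "P \<noteq> {}" "quadratic_dependency P"
      by (rule redundant_orbit_imp_dependency)
    have finP: "finite P" using P(1) supp(2) by (rule finite_subset)
    have finq: "finite q" if "q \<in> P" for q
      using that P(1) supp(1) finite_subset[of q "{1..n}"] by auto
    have "\<not> card {q \<in> P. 2 \<le> card q} \<le> 3"
      using dependency_few_large_members[OF finP P(3) _ finq] P(2) by blast
    moreover have "card {q \<in> P. 2 \<le> card q} \<le> card {q \<in> supp S1 n \<sigma>. 2 \<le> card q}"
      using P(1) supp(2) by (intro card_mono) auto
    ultimately have 1: "int (ind S1) - int t > 3" using supp(3) card n by linarith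
    have "ind S1 = 7" if "t \<le> 3"
    proof -
      have "{1..n} \<subseteq> {1..3}" using that n by simp
      then have "P \<subseteq> Pow {1..3}" using P(1) supp(1) by blast
      then have "P = Pow {1..3}" using dependency_three_variables P(2,3) by blast
      then have "8 \<le> card (supp S1 n \<sigma>)" using card_mono[OF supp(2) P(1)] by (simp add: card_Pow)
      moreover have "(2::nat) ^ n \<le> 2 ^ 3" using that n by (intro power_increasing) auto
      ultimately show ?thesis using le card by simp
    qed
    with 1 show ?thesis by blast
  qed
  moreover have "\<not> minimal_ears B Vdot R" if t3: "t \<le> 3" and "ind S1 = 7"
  proof -
    have c8: "card (supp S1 n \<sigma>) = 8" using card that by simp
    have "n = 3"
    proof (rule ccontr)
      assume "n \<noteq> 3"
      then have "(2::nat) ^ n \<le> 2 ^ 2" using t3 n by (intro power_increasing) auto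
      then show False using le c8 by simp
    qed
    moreover from this have "supp S1 n \<sigma> = Pow {1..n}"
      using supp(1) c8 by (intro card_subset_eq) (auto simp: card_Pow)
    ultimately obtain \<alpha> where "\<alpha> \<in> roots" "reflection_group (roots - orbit \<alpha>) = reflection_group roots"
      by (rule full_support_imp_redundant_orbit)
    then show ?thesis unfolding minimal by blast
  qed
  ultimately show ?thesis by (meson linorder_not_le)
qed

end
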